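(* Let $\alpha,\beta\in\mathbb{R}$ with $\beta\neq 0$, and let $(M^{n},g)$ be a (not necessarily compact) Chern Kähler-like Hermitian manifold of complex dimension $n$ with non-zero constant mixed curvature, i.e. there is a constant $c\neq0$ with $\mathcal{C}_{\alpha,\beta}(X)=c$ for every nonzero $(1,0)$-tangent vector $X$ at every point of $M$. If $(n+2)\alpha+4\beta\neq0$, then $g$ is Kähler.
   Context: For a Hermitian manifold $(M^n,g)$ of complex dimension $n$, the Chern connection is the connection preserving $g$ and the complex structure whose torsion has no $(1,1)$-component. Its curvature in local holomorphic coordinates is $$R_{i\bar j k\bar l}=-\frac{\partial^2 g_{k\bar l}}{\partial z^i\partial\bar z^j}+g^{p\bar q}\frac{\partial g_{k\bar q}}{\partial z^i}\frac{\partial g_{p\bar l}}{\partial \bar z^j}.$$ $(M,g)$ is called (Chern) Kähler-like if $R$ obeys all the Kähler symmetries, i.e. $R_{i\bar jk\bar l}=R_{k\bar ji\bar l}=R_{i\bar lk\bar j}=R_{k\bar l i\bar j}$ for all indices. The first Chern Ricci curvature is $Ric=-\sqrt{-1}\,\partial\bar\partial\log\det g$, with components $R_{i\bar j}=g^{k\bar l}R_{i\bar jk\bar l}$, and we write $Ric(X,\bar X)=R_{i\bar j}X^i\overline{X^j}$. The holomorphic sectional curvature is $H(X)=R(X,\bar X,X,\bar X)/|X|_g^4$. For $\alpha,\beta\in\mathbb{R}$ the mixed curvature is $$\mathcal{C}_{\alpha,\beta}(X)=\frac{\alpha}{|X|_g^2}Ric(X,\bar X)+\beta H(X),\qquad 0\ne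 X\in T^{1,0}M.$$ $g$ is Kähler if its associated $(1,1)$-form $\omega=\sqrt{-1}g_{i\bar j}dz^i\wedge d\bar z^j$ satisfies $d\omega=0$. *)

theory Defs
  imports "HOL-Analysis.Analysis"
begin

section \<open>Differential calculus on open subsets of complex coordinate space\<close>

fun times_differentiable_on ::
  "nat \<Rightarrow> ('a::real_normed_vector \<Rightarrow> 'b::real_normed_vector) \<Rightarrow> 'a set \<Rightarrow> bool" where
  "times_differentiable_on 0 f S \<longleftrightarrow> continuous_on S f"
| "times_differentiable_on (Suc m) f S \<longleftrightarrow>
     (\<forall>x\<in>S. f differentiable (at x)) \<and>
     (\<forall>v. times_differentiable_on m (\<lambda>x. frechet_derivative f (at x) v) S)"

text \<open>Real smoothness; meant for open \<open>S\<close>.\<close>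

definition smooth_on ::
  "('a::real_normed_vector \<Rightarrow> 'b::real_normed_vector) \<Rightarrow> 'a set \<Rightarrow> bool" where
  "smooth_on f S \<longleftrightarrow> (\<forall>m. times_differentiable_on m f S)"

text \<open>The library's \<open>holomorphic_on\<close> only covers one complex variable.\<close>

definition holomorphic_map_on ::
  "(complex^'n::finite \<Rightarrow> complex^'m::finite) \<Rightarrow> (complex^'n) set \<Rightarrow> bool" where
  "holomorphic_map_on f S \<longleftrightarrow>
     (\<forall>z\<in>S. \<exists>D. (f has_derivative D) (at z) \<and> (\<forall>a v. D (a *s v) = a *s D v))"

text \<open>
  Wirtinger operators: with \<open>z\<^sup>i = x\<^sup>i + \<i> y\<^sup>i\<close>, the vectors \<open>axis i 1\<close> and \<open>axis i \<i>\<close> are the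
  directions of the real coordinates \<open>x\<^sup>i\<close> and \<open>y\<^sup>i\<close>.
\<close>

definition d_dz :: "'n::finite \<Rightarrow> (complex^'n \<Rightarrow> complex) \<Rightarrow> complex^'n \<Rightarrow> complex" where
  "d_dz i f z = (frechet_derivative f (at z) (axis i 1)
                 - \<i> * frechet_derivative f (at z) (axis i \<i>)) / 2"

definition d_dzbar :: "'n::finite \<Rightarrow> (complex^'n \<Rightarrow> complex) \<Rightarrow> complex^'n \<Rightarrow> complex" where
  "d_dzbar i f z = (frechet_derivative f (at z) (axis i 1)
                    + \<i> * frechet_derivative f (at z) (axis i \<i>)) / 2"

text \<open>
  A 2-form \<open>\<eta>\<close> is given by its values \<open>\<eta> z u v\<close> on real tangent vectors; its exterior derivative
  is evaluated on constant vector fields, so that no bracket terms occur.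
\<close>

definition ext_deriv2 ::
  "('a::real_normed_vector \<Rightarrow> 'a \<Rightarrow> 'a \<Rightarrow> 'b::real_normed_vector) \<Rightarrow> 'a \<Rightarrow> 'a \<Rightarrow> 'a \<Rightarrow> 'a \<Rightarrow> 'b" where
  "ext_deriv2 \<eta> z u v w =
     frechet_derivative (\<lambda>x. \<eta> x v w) (at z) u
     - frechet_derivative (\<lambda>x. \<eta> x u w) (at z) v
     + frechet_derivative (\<lambda>x. \<eta> x u v) (at z) w"


section \<open>Complex manifolds\<close>

text \<open>
  A chart is a domain together with a coordinate map; the values of the map outside the domain are
  irrelevant. The complex dimension is \<open>CARD('n)\<close>.
\<close>

type_synonym ('a, 'n) chart = "'a set \<times> ('a \<Rightarrow> complex^'n)"

definition chart_image :: "('a, 'n::finite) chart \<Rightarrow> (complex^'n) set" where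
  "chart_image C = snd C ` fst C"

definition transition ::
  "('a, 'n::finite) chart \<Rightarrow> ('a, 'n) chart \<Rightarrow> complex^'n \<Rightarrow> complex^'n" where
  "transition C D = (\<lambda>z. snd D (inv_into (fst C) (snd C) z))"

definition complex_manifold :: "'a topology \<Rightarrow> ('a, 'n::finite) chart set \<Rightarrow> bool" where
  "complex_manifold M \<A> \<longleftrightarrow>
     Hausdorff_space M \<and> second_countable M \<and>
     (\<Union>C\<in>\<A>. fst C) = topspace M \<and>
     (\<forall>C\<in>\<A>. openin M (fst C) \<and> open (chart_image C) \<and>
        homeomorphic_map (subtopology M (fst C)) (top_of_set (chart_image C)) (snd C)) \<and>
     (\<forall>C\<in>\<A>. \<forall>D\<in>\<A>. holomorphic_map_on (transition C D) (snd C ` (fst C \<inter> fst D)))"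


section \<open>Hermitian metrics\<close>

text \<open>
  A metric is given by its matrices in all charts: \<open>g C z $ i $ j\<close> is the component
  \<open>g\<^bsub>i\<bar>j\<^esub>\<close> in the chart \<open>C\<close> at the point with coordinates \<open>z\<close>. Likewise a (1,0)-vector
  \<open>X\<^sup>i \<partial>/\<partial>z\<^sup>i\<close> is given by its components.
\<close>

definition hermitian_form :: "complex^'n^'n \<Rightarrow> complex^'n \<Rightarrow> complex^'n::finite \<Rightarrow> complex" where
  "hermitian_form G X Y = (\<Sum>i\<in>UNIV. \<Sum>j\<in>UNIV. G $ i $ j * X $ i * cnj (Y $ j))"

definition hermitian_pos_def :: "complex^'n^'n::finite \<Rightarrow> bool" where
  "hermitian_pos_def G \<longleftrightarrow>
     (\<forall>i j. G $ j $ i = cnj (G $ i $ j)) \<and> (\<forall>X. X \<noteq> 0 \<longrightarrow> Re (hermitian_form G X X) > 0)"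

definition hermitian_metric ::
  "('a, 'n::finite) chart set \<Rightarrow> (('a, 'n) chart \<Rightarrow> complex^'n \<Rightarrow> complex^'n^'n) \<Rightarrow> bool" where
  "hermitian_metric \<A> g \<longleftrightarrow>
     (\<forall>C\<in>\<A>. smooth_on (g C) (chart_image C) \<and>
        (\<forall>z\<in>chart_image C. hermitian_pos_def (g C z))) \<and>
     (\<forall>C\<in>\<A>. \<forall>D\<in>\<A>. \<forall>p\<in>fst C \<inter> fst D. \<forall>i j.
        g C (snd C p) $ i $ j =
          (\<Sum>k\<in>UNIV. \<Sum>l\<in>UNIV. g D (snd D p) $ k $ l
             * d_dz i (\<lambda>z. transition C D z $ k) (snd C p)
             * cnj (d_dz j (\<lambda>z. transition C D z $ l) (snd C p))))"

definition hermitian_manifold ::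
  "'a topology \<Rightarrow> ('a, 'n::finite) chart set \<Rightarrow>
   (('a, 'n) chart \<Rightarrow> complex^'n \<Rightarrow> complex^'n^'n) \<Rightarrow> bool" where
  "hermitian_manifold M \<A> g \<longleftrightarrow> complex_manifold M \<A> \<and> hermitian_metric \<A> g"

text \<open>The fundamental form \<open>\<i> g\<^bsub>i\<bar>j\<^esub> dz\<^sup>i \<and> d\<bar>z\<^sup>j\<close>, evaluated on real tangent vectors.\<close>

definition fundamental_form ::
  "(complex^'n \<Rightarrow> complex^'n^'n) \<Rightarrow> complex^'n \<Rightarrow> complex^'n \<Rightarrow> complex^'n::finite \<Rightarrow> complex" where
  "fundamental_form G z u v =
     \<i> * (\<Sum>i\<in>UNIV. \<Sum>j\<in>UNIV. G z $ i $ j * (u $ i * cnj (v $ j) - v $ i * cnj (u $ j)))"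

definition kaehler ::
  "('a, 'n::finite) chart set \<Rightarrow> (('a, 'n) chart \<Rightarrow> complex^'n \<Rightarrow> complex^'n^'n) \<Rightarrow> bool" where
  "kaehler \<A> g \<longleftrightarrow>
     (\<forall>C\<in>\<A>. \<forall>z\<in>chart_image C. \<forall>u v w. ext_deriv2 (fundamental_form (g C)) z u v w = 0)"


section \<open>Chern curvature\<close>

text \<open>
  In the following, \<open>G\<close> is the matrix function of the metric in one chart.
  The inverse components satisfy \<open>g\<^sup>p\<^sup>\<bar>\<^sup>q g\<^bsub>k\<bar>q\<^esub> = \<delta>\<^sup>p\<^sub>k\<close>, so \<open>g\<^sup>p\<^sup>\<bar>\<^sup>q\<close> is the \<open>(q, p)\<close> entry
  of the inverse matrix of \<open>(g\<^bsub>k\<bar>q\<^esub>)\<close>.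
\<close>

definition metric_inv :: "complex^'n^'n \<Rightarrow> 'n::finite \<Rightarrow> 'n \<Rightarrow> complex" where
  "metric_inv G p q = matrix_inv G $ q $ p"

definition chern_curvature ::
  "(complex^'n \<Rightarrow> complex^'n^'n) \<Rightarrow> complex^'n \<Rightarrow> 'n::finite \<Rightarrow> 'n \<Rightarrow> 'n \<Rightarrow> 'n \<Rightarrow> complex" where
  "chern_curvature G z i j k l =
     - d_dz i (d_dzbar j (\<lambda>x. G x $ k $ l)) z
     + (\<Sum>p\<in>UNIV. \<Sum>q\<in>UNIV. metric_inv (G z) p q
          * d_dz i (\<lambda>x. G x $ k $ q) z * d_dzbar j (\<lambda>x. G x $ p $ l) z)"

definition chern_kaehler_like ::
  "('a, 'n::finite) chart set \<Rightarrow> (('a, 'n) chart \<Rightarrow> complex^'n \<Rightarrow> complex^'n^'n) \<Rightarrow> bool" where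
  "chern_kaehler_like \<A> g \<longleftrightarrow>
     (\<forall>C\<in>\<A>. \<forall>z\<in>chart_image C. \<forall>i j k l.
        chern_curvature (g C) z i j k l = chern_curvature (g C) z k j i l \<and>
        chern_curvature (g C) z i j k l = chern_curvature (g C) z i l k j \<and>
        chern_curvature (g C) z i j k l = chern_curvature (g C) z k l i j)"

text \<open>
  The components \<open>R\<^bsub>i\<bar>j\<^esub>\<close> of \<open>Ric = - \<i> \<partial>\<bar>\<partial> log det g = \<i> R\<^bsub>i\<bar>j\<^esub> dz\<^sup>i \<and> d\<bar>z\<^sup>j\<close>, which are
  the traces \<open>g\<^sup>k\<^sup>\<bar>\<^sup>l R\<^bsub>i\<bar>jk\<bar>l\<^esub>\<close>. The determinant is a positive real.
\<close>

definition chern_ricci ::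
  "(complex^'n \<Rightarrow> complex^'n^'n) \<Rightarrow> complex^'n \<Rightarrow> 'n::finite \<Rightarrow> 'n \<Rightarrow> complex" where
  "chern_ricci G z i j = - d_dz i (d_dzbar j (\<lambda>x. Ln (det (G x)))) z"

definition ricci_form_value ::
  "(complex^'n \<Rightarrow> complex^'n^'n) \<Rightarrow> complex^'n \<Rightarrow> complex^'n::finite \<Rightarrow> complex" where
  "ricci_form_value G z X = (\<Sum>i\<in>UNIV. \<Sum>j\<in>UNIV. chern_ricci G z i j * X $ i * cnj (X $ j))"

definition holomorphic_sectional_curvature ::
  "(complex^'n \<Rightarrow> complex^'n^'n) \<Rightarrow> complex^'n \<Rightarrow> complex^'n::finite \<Rightarrow> complex" where
  "holomorphic_sectional_curvature G z X =
     (\<Sum>i\<in>UNIV. \<Sum>j\<in>UNIV. \<Sum>k\<in>UNIV. \<Sum>l\<in>UNIV.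
        chern_curvature G z i j k l * X $ i * cnj (X $ j) * X $ k * cnj (X $ l))
     / (hermitian_form (G z) X X)\<^sup>2"

text \<open>The value is complex-typed, although it is real for a Hermitian metric.\<close>

definition mixed_curvature ::
  "real \<Rightarrow> real \<Rightarrow> (complex^'n \<Rightarrow> complex^'n^'n) \<Rightarrow> complex^'n \<Rightarrow> complex^'n::finite \<Rightarrow> complex" where
  "mixed_curvature \<alpha> \<beta> G z X =
     of_real \<alpha> / hermitian_form (G z) X X * ricci_form_value G z X
     + of_real \<beta> * holomorphic_sectional_curvature G z X"

definition constant_mixed_curvature ::
  "('a, 'n::finite) chart set \<Rightarrow> (('a, 'n) chart \<Rightarrow> complex^'n \<Rightarrow> complex^'n^'n) \<Rightarrow>
   real \<Rightarrow> real \<Rightarrow> real \<Rightarrow> bool" where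
  "constant_mixed_curvature \<A> g \<alpha> \<beta> c \<longleftrightarrow>
     (\<forall>C\<in>\<A>. \<forall>z\<in>chart_image C. \<forall>X. X \<noteq> 0 \<longrightarrow> mixed_curvature \<alpha> \<beta> (g C) z X = of_real c)"

end

theory Submission
  imports Defs
begin

text \<open>
  The proof is pointwise linear algebra followed by one application of \<open>d \<circ> d = 0\<close>.

  At a point, the hypothesis reads
  \<open>\<alpha> Ric(X,X) |X|\<^sup>2 + \<beta> R(X,X,X,X) = c |X|\<^sup>4\<close> (conjugations omitted) for all \<open>X\<close>. Both sides are
  homogeneous of degree 2 in \<open>X\<close> and of degree 2 in its conjugate. For a Kaehler-like metric the
  coefficients can be symmetrized in the two holomorphic and in the two antiholomorphic slots
  without changing \<open>R\<close>, so polarization (\<open>symmetric_biquadratic_eq_0_imp\<close>) gives an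
  identity of tensors. Tracing it over the last two slots gives
  \<open>((n+2)\<alpha> + 4\<beta>) Ric = (2c(n+1) - \<alpha>s) g\<close> with \<open>s\<close> the trace of \<open>Ric\<close>; a second trace
  determines \<open>s\<close>, and eliminating it leaves
  \<open>((n+1)\<alpha> + 2\<beta>) Ric = c(n+1) g\<close> (\<open>ricci_proportional_of_constant_mixed\<close>). The
  elimination cancels the factor \<open>(n+2)\<alpha> + 4\<beta>\<close>, which is where its being non-zero enters.

  Since \<open>c \<noteq> 0\<close>, the metric is therefore a constant multiple of its Chern Ricci curvature. The
  latter is \<open>- \<partial>\<^sub>i \<partial>\<^bsub>\<bar>j\<^esub> log det g\<close>, so the fundamental form is a constant multiple of a
  \<open>\<partial>\<bar>\<partial>\<close>-exact form and hence closed (\<open>ricci_proportional_imp_closed\<close>).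

  Two classical facts support this. Jacobi's formula \<open>det_has_derivative\<close> identifies
  \<open>- \<partial>\<^sub>i \<partial>\<^bsub>\<bar>j\<^esub> log det g\<close> with the trace of the Chern curvature (\<open>chern_ricci_eq_trace\<close>), and the
  symmetry of second derivatives (\<open>second_derivative_symmetric\<close>) gives \<open>\<partial> \<circ> \<partial> = 0\<close>. To have a
  smooth \<open>log det g\<close> one also needs \<open>det g\<close> to avoid the branch cut of the logarithm
  (\<open>hermitian_pos_def_det_pos\<close>).
\<close>

section \<open>Smooth functions\<close>

lemma frechet_derivative_eq:
  assumes "(f has_derivative D) (at x)"
  shows "frechet_derivative f (at x) = D"
  using assms by (rule frechet_derivative_at [symmetric])

lemma times_differentiable_on_cong:
  assumes "open S" "\<And>x. x \<in> S \<Longrightarrow> f x = g x" "times_differentiable_on m f S"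
  shows "times_differentiable_on m g S"
  using assms(2,3)
proof (induction m arbitrary: f g)
  case 0
  then show ?case by (metis continuous_on_cong times_differentiable_on.simps(1))
next
  case (Suc m)
  have d: "(g has_derivative frechet_derivative f (at x)) (at x)" if "x \<in> S" for x
    using Suc.prems that assms(1) frechet_derivative_works has_derivative_transform_within_open
    by (metis times_differentiable_on.simps(2))
  moreover have "times_differentiable_on m (\<lambda>x. frechet_derivative g (at x) v) S" for v
    by (rule Suc.IH [of "\<lambda>x. frechet_derivative f (at x) v"])
      (use Suc.prems frechet_derivative_eq [OF d] in auto)
  ultimately show ?case by (auto simp: differentiable_def)
qed

text \<open>
  The recursive definition speaks of the derivative chosen by \<open>frechet_derivative\<close>. This form lets
  the closure proofs below supply an explicit formula for it instead.
\<close>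

lemma times_differentiable_on_SucI:
  assumes "open S" "\<And>x. x \<in> S \<Longrightarrow> (f has_derivative D x) (at x)"
    "\<And>v. times_differentiable_on m (\<lambda>x. D x v) S"
  shows "times_differentiable_on (Suc m) f S"
proof -
  have "times_differentiable_on m (\<lambda>x. frechet_derivative f (at x) v) S" for v
    by (rule times_differentiable_on_cong [OF assms(1) _ assms(3)])
      (use frechet_derivative_eq [OF assms(2)] in auto)
  then show ?thesis using assms(2) by (auto simp: differentiable_def)
qed

lemma times_differentiable_on_SucD:
  "times_differentiable_on (Suc m) f S \<Longrightarrow> times_differentiable_on m f S"
proof (induction m arbitrary: f)
  case 0
  then show ?case
    by (simp add: differentiable_at_imp_differentiable_on differentiable_imp_continuous_on)
next
  case (Suc m)
  have "\<forall>x\<in>S. f differentiable (at x)" 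
    "\<And>v. times_differentiable_on (Suc m) (\<lambda>x. frechet_derivative f (at x) v) S"
    using Suc.prems by auto
  then show ?case using Suc.IH by simp
qed

lemma smooth_on_differentiable:
  assumes "smooth_on f S" "x \<in> S"
  shows "f differentiable (at x)"
  using assms(1)[unfolded smooth_on_def, rule_format, of 1] assms(2) by auto

lemma smooth_on_has_derivative:
  assumes "smooth_on f S" "x \<in> S"
  shows "(f has_derivative frechet_derivative f (at x)) (at x)"
  using smooth_on_differentiable [OF assms] frechet_derivative_works by blast

lemma smooth_on_continuous: "smooth_on f S \<Longrightarrow> continuous_on S f"
  unfolding smooth_on_def by (metis times_differentiable_on.simps(1))

lemma smooth_on_frechet_derivative:
  "smooth_on f S \<Longrightarrow> smooth_on (\<lambda>x. frechet_derivative f (at x) v) S"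
  unfolding smooth_on_def by (metis times_differentiable_on.simps(2))

lemma smooth_on_const: "smooth_on (\<lambda>x. c) S"
proof -
  have "times_differentiable_on m (\<lambda>x. c) S" for m
    by (induction m arbitrary: c) auto
  then show ?thesis by (simp add: smooth_on_def)
qed

lemma smooth_on_bounded_linear:
  assumes "open S" "bounded_linear L" "smooth_on f S"
  shows "smooth_on (\<lambda>x. L (f x)) S"
proof -
  have "times_differentiable_on m f S \<Longrightarrow> times_differentiable_on m (\<lambda>x. L (f x)) S" for m
  proof (induction m arbitrary: f)
    case 0
    then show ?case
      using assms(2) by (simp add: bounded_linear.continuous_on)
  next
    case (Suc m)
    have "((\<lambda>x. L (f x)) has_derivative (\<lambda>v. L (frechet_derivative f (at x) v))) (at x)"
      if "x \<in> S" for x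
      using Suc.prems that
      by (intro bounded_linear.has_derivative [OF assms(2)]) (auto simp flip: frechet_derivative_works)
    then show ?case
      by (rule times_differentiable_on_SucI [OF assms(1)]) (use Suc in auto)
  qed
  then show ?thesis using assms(3) by (simp add: smooth_on_def)
qed

lemma times_differentiable_on_add:
  assumes "open S" "times_differentiable_on m f S" "times_differentiable_on m g S"
  shows "times_differentiable_on m (\<lambda>x. f x + g x) S"
  using assms(2,3)
proof (induction m arbitrary: f g)
  case 0
  then show ?case by (simp add: continuous_on_add)
next
  case (Suc m)
  have "((\<lambda>x. f x + g x) has_derivative
      (\<lambda>v. frechet_derivative f (at x) v + frechet_derivative g (at x) v)) (at x)"
    if "x \<in> S" for x
    using Suc.prems that by (auto intro!: has_derivative_add simp: frechet_derivative_works)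
  then show ?case
    by (rule times_differentiable_on_SucI [OF assms(1)]) (use Suc in auto)
qed

lemma times_differentiable_on_mult:
  fixes f g :: "'a::real_normed_vector \<Rightarrow> 'b::real_normed_algebra"
  assumes "open S" "times_differentiable_on m f S" "times_differentiable_on m g S"
  shows "times_differentiable_on m (\<lambda>x. f x * g x) S"
  using assms(2,3)
proof (induction m arbitrary: f g)
  case 0
  then show ?case by (simp add: continuous_on_mult)
next
  case (Suc m)
  have "((\<lambda>x. f x * g x) has_derivative
      (\<lambda>v. f x * frechet_derivative g (at x) v + frechet_derivative f (at x) v * g x)) (at x)"
    if "x \<in> S" for x
    using Suc.prems that by (auto intro!: has_derivative_mult simp: frechet_derivative_works)
  moreover have "times_differentiable_on m f S" "times_differentiable_on m g S"
    using Suc.prems times_differentiable_on_SucD by blast+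
  then have "times_differentiable_on m
      (\<lambda>x. f x * frechet_derivative g (at x) v + frechet_derivative f (at x) v * g x) S" for v
    using Suc by (intro times_differentiable_on_add assms(1)) auto
  ultimately show ?case
    by (rule times_differentiable_on_SucI [OF assms(1)])
qed

lemma smooth_on_add:
  "open S \<Longrightarrow> smooth_on f S \<Longrightarrow> smooth_on g S \<Longrightarrow> smooth_on (\<lambda>x. f x + g x) S"
  by (simp add: smooth_on_def times_differentiable_on_add)

lemma smooth_on_mult:
  fixes f g :: "'a::real_normed_vector \<Rightarrow> 'b::real_normed_algebra"
  shows "open S \<Longrightarrow> smooth_on f S \<Longrightarrow> smooth_on g S \<Longrightarrow> smooth_on (\<lambda>x. f x * g x) S"
  by (simp add: smooth_on_def times_differentiable_on_mult)

lemma smooth_on_sum: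
  "open S \<Longrightarrow> (\<And>i. i \<in> I \<Longrightarrow> smooth_on (f i) S) \<Longrightarrow> smooth_on (\<lambda>x. \<Sum>i\<in>I. f i x) S"
  by (induction I rule: infinite_finite_induct) (auto intro: smooth_on_const smooth_on_add)

lemma smooth_on_prod:
  fixes f :: "'i \<Rightarrow> 'a::real_normed_vector \<Rightarrow> 'b::{real_normed_algebra, comm_ring_1}"
  shows "open S \<Longrightarrow> (\<And>i. i \<in> I \<Longrightarrow> smooth_on (f i) S) \<Longrightarrow> smooth_on (\<lambda>x. \<Prod>i\<in>I. f i x) S"
  by (induction I rule: infinite_finite_induct) (auto intro: smooth_on_const smooth_on_mult)

lemma smooth_on_inverse:
  fixes f :: "'a::real_normed_vector \<Rightarrow> 'b::real_normed_field"
  assumes "open S" "smooth_on f S" "\<And>x. x \<in> S \<Longrightarrow> f x \<noteq> 0"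
  shows "smooth_on (\<lambda>x. inverse (f x)) S"
proof -
  have "times_differentiable_on m (\<lambda>x. inverse (f x)) S" for m
  proof (induction m)
    case 0
    then show ?case
      using assms smooth_on_continuous by (auto intro!: continuous_on_inverse)
  next
    case (Suc m)
    have d: "((\<lambda>x. inverse (f x)) has_derivative
        (\<lambda>v. - (inverse (f x) * frechet_derivative f (at x) v * inverse (f x)))) (at x)"
      if "x \<in> S" for x
      using assms that smooth_on_has_derivative by (intro Deriv.has_derivative_inverse) auto
    have "times_differentiable_on m (\<lambda>x. frechet_derivative f (at x) v) S" for v
      using smooth_on_frechet_derivative [OF assms(2)] by (simp add: smooth_on_def)
    then have "times_differentiable_on m
        (\<lambda>x. (-1) * (inverse (f x) * frechet_derivative f (at x) v * inverse (f x))) S" for v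
      using Suc smooth_on_const [of "-1::'b" S]
      by (intro times_differentiable_on_mult assms(1)) (auto simp: smooth_on_def)
    then show ?case
      by (intro times_differentiable_on_SucI [OF assms(1) d]) auto
  qed
  then show ?thesis by (simp add: smooth_on_def)
qed

lemma has_derivative_Ln_comp:
  fixes f :: "'a::real_normed_vector \<Rightarrow> complex"
  assumes "(f has_derivative D) (at x)" "f x \<notin> \<real>\<^sub>\<le>\<^sub>0"
  shows "((\<lambda>x. Ln (f x)) has_derivative (\<lambda>v. inverse (f x) * D v)) (at x)"
  using has_derivative_compose [OF assms(1)] has_field_derivative_Ln [OF assms(2)]
  by (simp add: has_field_derivative_def)

text \<open>
  The derivative of \<open>Ln \<circ> f\<close> is \<open>f' / f\<close>, in which the logarithm no longer occurs; its smoothness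
  therefore follows from the closure properties above without a further induction.
\<close>

lemma smooth_on_Ln:
  fixes f :: "'a::real_normed_vector \<Rightarrow> complex"
  assumes "open S" "smooth_on f S" "\<And>x. x \<in> S \<Longrightarrow> f x \<notin> \<real>\<^sub>\<le>\<^sub>0"
  shows "smooth_on (\<lambda>x. Ln (f x)) S"
proof -
  have "times_differentiable_on (Suc m) (\<lambda>x. Ln (f x)) S" for m
  proof (rule times_differentiable_on_SucI [OF assms(1)])
    show "((\<lambda>x. Ln (f x)) has_derivative
        (\<lambda>v. inverse (f x) * frechet_derivative f (at x) v)) (at x)" if "x \<in> S" for x
      using assms that smooth_on_has_derivative by (intro has_derivative_Ln_comp) auto
    have "\<And>x. x \<in> S \<Longrightarrow> f x \<noteq> 0" using assms(3) by fastforce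
    then have "smooth_on (\<lambda>x. inverse (f x) * frechet_derivative f (at x) v) S" for v
      by (intro smooth_on_mult smooth_on_inverse smooth_on_frechet_derivative assms)
    then show "times_differentiable_on m (\<lambda>x. inverse (f x) * frechet_derivative f (at x) v) S" for v
      by (simp add: smooth_on_def)
  qed
  then show ?thesis using times_differentiable_on_SucD unfolding smooth_on_def by blast
qed

section \<open>Symmetry of second derivatives\<close>

text \<open>
  The mean value theorem is applied first along \<open>u\<close> to the difference of \<open>f\<close> on two parallel edges
  of a parallelogram, then along \<open>v\<close> to the derivative. The left-hand side is symmetric in \<open>u\<close> and
  \<open>v\<close>, whereas the right-hand side is a second derivative in a definite order.
\<close>

lemma second_difference_eq:
  fixes f :: "'a::real_normed_vector \<Rightarrow> real"
  assumes f: "smooth_on f S" and h: "h > 0"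
    and sq: "\<And>s t. 0 \<le> s \<Longrightarrow> s \<le> h \<Longrightarrow> 0 \<le> t \<Longrightarrow> t \<le> h \<Longrightarrow> z + s *\<^sub>R u + t *\<^sub>R v \<in> S"
  obtains s t where "0 < s" "s < h" "0 < t" "t < h"
    "f (z + h *\<^sub>R u + h *\<^sub>R v) - f (z + h *\<^sub>R u) - f (z + h *\<^sub>R v) + f z
      = h\<^sup>2 * frechet_derivative (\<lambda>x. frechet_derivative f (at x) u) (at (z + s *\<^sub>R u + t *\<^sub>R v)) v"
proof -
  define fu where "fu = (\<lambda>x. frechet_derivative f (at x) u)"
  have line: "((\<lambda>s. k (a + s *\<^sub>R w)) has_real_derivative frechet_derivative k (at (a + s *\<^sub>R w)) w) (at s)"
    if "smooth_on k S" "a + s *\<^sub>R w \<in> S" for k :: "'a \<Rightarrow> real" and a w s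
  proof -
    have "((\<lambda>s. k (a + s *\<^sub>R w)) has_derivative (\<lambda>r. frechet_derivative k (at (a + s *\<^sub>R w)) (r *\<^sub>R w))) (at s)"
      by (rule has_derivative_compose [where f = "\<lambda>s. a + s *\<^sub>R w" and g = k])
        (use smooth_on_has_derivative [OF that] in \<open>auto intro!: derivative_eq_intros\<close>)
    moreover have "linear (frechet_derivative k (at (a + s *\<^sub>R w)))"
      using linear_frechet_derivative smooth_on_differentiable [OF that] by blast
    ultimately show ?thesis
      by (simp add: has_field_derivative_def linear_scale mult_commute_abs)
  qed
  define p where "p = (\<lambda>s. f (z + h *\<^sub>R v + s *\<^sub>R u) - f (z + s *\<^sub>R u))"
  have p': "(p has_real_derivative fu (z + h *\<^sub>R v + s *\<^sub>R u) - fu (z + s *\<^sub>R u)) (at s)"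
    if "0 \<le> s" "s \<le> h" for s
    unfolding p_def fu_def
    using sq [of s h] sq [of s 0] that h
    by (intro DERIV_diff line f) (auto simp: add_ac)
  obtain s where s: "0 < s" "s < h"
    "p h - p 0 = (h - 0) * (fu (z + h *\<^sub>R v + s *\<^sub>R u) - fu (z + s *\<^sub>R u))"
    using MVT2 [OF h p'] by auto
  define q where "q = (\<lambda>t. fu (z + s *\<^sub>R u + t *\<^sub>R v))"
  have q': "(q has_real_derivative frechet_derivative fu (at (z + s *\<^sub>R u + t *\<^sub>R v)) v) (at t)"
    if "0 \<le> t" "t \<le> h" for t
    unfolding q_def
    by (rule line) (use s sq [of s t] that f in \<open>auto simp: fu_def intro: smooth_on_frechet_derivative\<close>)
  obtain t where t: "0 < t" "t < h"
    "q h - q 0 = (h - 0) * frechet_derivative fu (at (z + s *\<^sub>R u + t *\<^sub>R v)) v"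
    using MVT2 [OF h q'] by auto
  show thesis
  proof (rule that [OF s(1,2) t(1,2)])
    have "p h - p 0 = h\<^sup>2 * frechet_derivative fu (at (z + s *\<^sub>R u + t *\<^sub>R v)) v"
      using s(3) t(3) by (simp add: q_def power2_eq_square add_ac)
    then show "f (z + h *\<^sub>R u + h *\<^sub>R v) - f (z + h *\<^sub>R u) - f (z + h *\<^sub>R v) + f z
      = h\<^sup>2 * frechet_derivative (\<lambda>x. frechet_derivative f (at x) u) (at (z + s *\<^sub>R u + t *\<^sub>R v)) v"
      by (simp add: p_def fu_def add_ac)
  qed
qed

text \<open>
  On small parallelograms both orders of differentiation compute the same second difference, at
  points that tend to \<open>z\<close>; continuity of the second derivatives does the rest.
\<close>

lemma second_derivative_symmetric_real:
  fixes f :: "'a::real_normed_vector \<Rightarrow> real"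
  assumes f: "smooth_on f S" and S: "open S" and z: "z \<in> S"
  shows "frechet_derivative (\<lambda>x. frechet_derivative f (at x) u) (at z) v
       = frechet_derivative (\<lambda>x. frechet_derivative f (at x) v) (at z) u"
proof -
  define A where "A = (\<lambda>u v x. frechet_derivative (\<lambda>x. frechet_derivative f (at x) u) (at x) v)"
  have cont: "isCont (A u v) z" for u v
    using smooth_on_continuous [OF smooth_on_frechet_derivative [OF smooth_on_frechet_derivative [OF f]]]
      S z unfolding A_def by (simp add: continuous_on_eq_continuous_at)
  have "\<bar>A u v z - A v u z\<bar> \<le> 2 * e" if e: "e > 0" for e
  proof -
    have "\<forall>\<^sub>F x in nhds z. x \<in> S \<and> dist (A u v x) (A u v z) < e \<and> dist (A v u x) (A v u z) < e"
      using cont [of u v] cont [of v u] S z e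
      by (intro eventually_conj)
        (auto simp: eventually_nhds_in_open continuous_at_imp_continuous_at_within
          isCont_def tendsto_at_iff_tendsto_nhds dest!: tendstoD)
    then obtain d where d: "d > 0" and
      near: "\<And>x. dist x z < d \<Longrightarrow> x \<in> S \<and> dist (A u v x) (A u v z) < e \<and> dist (A v u x) (A v u z) < e"
      unfolding eventually_nhds_metric by blast
    \<comment> \<open>With this side length the whole parallelogram stays within distance \<open>d\<close> of \<open>z\<close>.\<close>
    define h where "h = d / (norm u + norm v + 1)"
    have n: "norm u + norm v + 1 > 0" by (smt (verit) norm_ge_zero)
    have h: "h > 0" using d n by (simp add: h_def)
    have close: "dist (z + s *\<^sub>R u + t *\<^sub>R v) z < d" if "0 \<le> s" "s \<le> h" "0 \<le> t" "t \<le> h" for s t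
    proof -
      have "norm (s *\<^sub>R u + t *\<^sub>R v) \<le> s * norm u + t * norm v"
        using norm_triangle_ineq [of "s *\<^sub>R u" "t *\<^sub>R v"] that by simp
      also have "\<dots> \<le> h * norm u + h * norm v"
        using that by (intro add_mono mult_right_mono) auto
      also have "\<dots> < h * (norm u + norm v + 1)" using h by (simp add: algebra_simps)
      also have "\<dots> = d" using n by (simp add: h_def)
      finally show ?thesis by (simp add: dist_norm add.assoc)
    qed
    obtain s t where 1: "0 < s" "s < h" "0 < t" "t < h"
      "f (z + h *\<^sub>R u + h *\<^sub>R v) - f (z + h *\<^sub>R u) - f (z + h *\<^sub>R v) + f z
        = h\<^sup>2 * A u v (z + s *\<^sub>R u + t *\<^sub>R v)"
      using second_difference_eq [OF f h, of z u v] close near unfolding A_def by metis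
    have close': "dist (z + s *\<^sub>R v + t *\<^sub>R u) z < d" if "0 \<le> s" "s \<le> h" "0 \<le> t" "t \<le> h" for s t
      using close [of t s] that by (simp add: add_ac)
    obtain s' t' where 2: "0 < s'" "s' < h" "0 < t'" "t' < h"
      "f (z + h *\<^sub>R v + h *\<^sub>R u) - f (z + h *\<^sub>R v) - f (z + h *\<^sub>R u) + f z
        = h\<^sup>2 * A v u (z + s' *\<^sub>R v + t' *\<^sub>R u)"
      using second_difference_eq [OF f h, of z v u] close' near unfolding A_def by metis
    have swap: "z + h *\<^sub>R v + h *\<^sub>R u = z + h *\<^sub>R u + h *\<^sub>R v" by (simp add: add_ac)
    have "h\<^sup>2 * A u v (z + s *\<^sub>R u + t *\<^sub>R v) = h\<^sup>2 * A v u (z + s' *\<^sub>R v + t' *\<^sub>R u)"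
      using 1(5) 2(5) unfolding swap by linarith
    then have "A u v (z + s *\<^sub>R u + t *\<^sub>R v) = A v u (z + s' *\<^sub>R v + t' *\<^sub>R u)"
      using h by simp
    moreover have "dist (A u v (z + s *\<^sub>R u + t *\<^sub>R v)) (A u v z) < e"
      using near close 1 by simp
    moreover have "dist (A v u (z + s' *\<^sub>R v + t' *\<^sub>R u)) (A v u z) < e"
      using near close' 2 by simp
    ultimately show ?thesis by (simp add: dist_real_def)
  qed
  from this [of "\<bar>A u v z - A v u z\<bar> / 4"] show ?thesis
    unfolding A_def by (cases "A u v z = A v u z") (auto simp: A_def)
qed

lemma frechet_derivative_bounded_linear:
  assumes "bounded_linear L" "f differentiable (at x)"
  shows "frechet_derivative (\<lambda>x. L (f x)) (at x) v = L (frechet_derivative f (at x) v)"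
  using frechet_derivative_eq [OF bounded_linear.has_derivative [OF assms(1)
      assms(2) [unfolded frechet_derivative_works]]] by simp

text \<open>
  Reduction to real values by taking components, because the mean value theorem has no
  vector-valued version with equality.
\<close>

lemma second_derivative_symmetric:
  fixes f :: "'a::real_normed_vector \<Rightarrow> 'b::euclidean_space"
  assumes f: "smooth_on f S" and S: "open S" and z: "z \<in> S"
  shows "frechet_derivative (\<lambda>x. frechet_derivative f (at x) u) (at z) v
       = frechet_derivative (\<lambda>x. frechet_derivative f (at x) v) (at z) u"
proof (rule euclidean_eqI)
  fix b :: 'b
  have bl: "bounded_linear (\<lambda>y. y \<bullet> b)" by (rule bounded_linear_inner_left)
  have *: "frechet_derivative (\<lambda>x. frechet_derivative (\<lambda>x. f x \<bullet> b) (at x) u) (at z) v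
      = frechet_derivative (\<lambda>x. frechet_derivative f (at x) u) (at z) v \<bullet> b" for u v
  proof -
    have "frechet_derivative (\<lambda>x. frechet_derivative (\<lambda>x. f x \<bullet> b) (at x) u) (at z) v
      = frechet_derivative (\<lambda>x. frechet_derivative f (at x) u \<bullet> b) (at z) v"
    proof (rule fun_cong [OF frechet_derivative_transform_within_open [OF _ S z]])
      show "(\<lambda>x. frechet_derivative (\<lambda>x. f x \<bullet> b) (at x) u) differentiable (at z)"
        by (rule smooth_on_differentiable [OF _ z])
          (intro smooth_on_frechet_derivative smooth_on_bounded_linear [OF S bl] f)
    qed (rule frechet_derivative_bounded_linear [OF bl smooth_on_differentiable [OF f]])
    also have "\<dots> = frechet_derivative (\<lambda>x. frechet_derivative f (at x) u) (at z) v \<bullet> b"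
      by (rule frechet_derivative_bounded_linear [OF bl])
        (rule smooth_on_differentiable [OF smooth_on_frechet_derivative [OF f] z])
    finally show ?thesis .
  qed
  show "frechet_derivative (\<lambda>x. frechet_derivative f (at x) u) (at z) v \<bullet> b
       = frechet_derivative (\<lambda>x. frechet_derivative f (at x) v) (at z) u \<bullet> b"
    unfolding * [symmetric]
    by (rule second_derivative_symmetric_real [OF smooth_on_bounded_linear [OF S bl f] S z])
qed

section \<open>Determinants and inverses of matrix functions\<close>

lemma smooth_on_component2:
  fixes G :: "'a::real_normed_vector \<Rightarrow> complex^'n^'m"
  assumes "open S" "smooth_on G S"
  shows "smooth_on (\<lambda>x. G x $ i $ j) S"
  by (rule smooth_on_bounded_linear [OF assms(1) _ assms(2)])
    (rule bounded_linear_compose [OF bounded_linear_vec_nth bounded_linear_vec_nth])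

lemma smooth_on_det:
  fixes G :: "'a::real_normed_vector \<Rightarrow> complex^'n^'n"
  assumes "open S" "\<And>i j. smooth_on (\<lambda>x. G x $ i $ j) S"
  shows "smooth_on (\<lambda>x. det (G x)) S"
  unfolding det_def
  by (intro smooth_on_sum smooth_on_mult smooth_on_prod smooth_on_const assms)

lemma matrix_inv_inverse:
  fixes A :: "'a::field^'n^'n"
  assumes "det A \<noteq> 0"
  shows "A ** matrix_inv A = mat 1" "matrix_inv A ** A = mat 1"
proof -
  have "\<exists>B. A ** B = mat 1 \<and> B ** A = mat 1"
    using assms by (simp flip: invertible_det_nz add: invertible_def)
  from someI_ex [OF this] show "A ** matrix_inv A = mat 1" "matrix_inv A ** A = mat 1"
    by (auto simp: matrix_inv_def)
qed

lemma metric_inv_left: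
  assumes "det A \<noteq> 0"
  shows "(\<Sum>q\<in>UNIV. metric_inv A p q * A $ k $ q) = (if p = k then 1 else 0)"
  using matrix_inv_inverse(1) [OF assms, THEN arg_cong, of "\<lambda>B. B $ k $ p"]
  by (simp add: metric_inv_def matrix_matrix_mult_def mat_def mult.commute [of "A $ _ $ _"] eq_commute [of p])

lemma metric_inv_right:
  assumes "det A \<noteq> 0"
  shows "(\<Sum>p\<in>UNIV. metric_inv A p q * A $ p $ l) = (if q = l then 1 else 0)"
  using matrix_inv_inverse(2) [OF assms, THEN arg_cong, of "\<lambda>B. B $ q $ l"]
  by (simp add: metric_inv_def matrix_matrix_mult_def mat_def)

text \<open>
  Cramer's rule makes it visible that the inverse metric is as smooth as the metric.
\<close>

lemma metric_inv_cramer: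
  assumes "det A \<noteq> 0"
  shows "metric_inv A p q
    = det (\<chi> i j. if j = q then (if i = p then 1 else 0) else A $ i $ j) * inverse (det A)"
proof -
  have "A *v (\<chi> k. metric_inv A p k) = (\<chi> i. if i = p then 1 else 0)"
    using metric_inv_left [OF assms, of p]
    by (auto simp: matrix_vector_mult_def vec_eq_iff mult.commute [of "A $ _ $ _"])
  then have "(\<chi> k. metric_inv A p k) =
      (\<chi> k. det (\<chi> i j. if j = k then (\<chi> i. if i = p then 1 else 0) $ i else A $ i $ j) / det A)"
    using cramer [OF assms] by metis
  then show ?thesis by (simp add: vec_eq_iff divide_inverse cong: if_cong)
qed

lemma smooth_on_metric_inv:
  fixes G :: "'a::real_normed_vector \<Rightarrow> complex^'n^'n"
  assumes S: "open S" and G: "\<And>i j. smooth_on (\<lambda>x. G x $ i $ j) S"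
    and det: "\<And>x. x \<in> S \<Longrightarrow> det (G x) \<noteq> 0"
  shows "smooth_on (\<lambda>x. metric_inv (G x) p q) S"
proof -
  define N where "N = (\<lambda>x. \<chi> i j. if j = q then (if i = p then 1 else 0) else G x $ i $ j)"
  have "smooth_on (\<lambda>x. N x $ i $ j) S" for i j
    using G smooth_on_const by (cases "j = q") (auto simp: N_def)
  then have N: "smooth_on (\<lambda>x. det (N x) * inverse (det (G x))) S"
    by (intro smooth_on_mult smooth_on_inverse S det smooth_on_det G)
  have eq: "det (N x) * inverse (det (G x)) = metric_inv (G x) p q" if "x \<in> S" for x
    using metric_inv_cramer [OF det [OF that]] by (simp add: N_def)
  have "times_differentiable_on m (\<lambda>x. metric_inv (G x) p q) S" for m
    by (rule times_differentiable_on_cong [OF S eq]) (use N in \<open>auto simp: smooth_on_def\<close>)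
  then show ?thesis by (simp add: smooth_on_def)
qed

text \<open>
  Jacobi's formula. The product rule yields a sum of determinants in which the \<open>i\<close>-th row of the
  matrix is replaced by its derivative. If the derivative matrix is written as \<open>D = (D A\<^sup>-\<^sup>1) A\<close>,
  its \<open>i\<close>-th row is a linear combination of the rows of \<open>A\<close>; only the \<open>i\<close>-th coefficient
  survives in the determinant, and these coefficients sum to the trace of \<open>D A\<^sup>-\<^sup>1\<close>.
\<close>

lemma det_has_derivative:
  fixes G :: "'a::real_normed_vector \<Rightarrow> complex^'n^'n"
  assumes G: "\<And>i j. ((\<lambda>x. G x $ i $ j) has_derivative D i j) (at x)" and det: "det (G x) \<noteq> 0"
  shows "((\<lambda>x. det (G x)) has_derivative
    (\<lambda>v. det (G x) * (\<Sum>i\<in>UNIV. \<Sum>j\<in>UNIV. metric_inv (G x) i j * D i j v))) (at x)"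
proof -
  have "((\<lambda>x. det (G x)) has_derivative (\<lambda>v. \<Sum>p | p permutes UNIV. of_int (sign p) *
      (\<Sum>i\<in>UNIV. D i (p i) v * (\<Prod>j\<in>UNIV - {i}. G x $ j $ p j)))) (at x)"
    unfolding det_def
    by (intro has_derivative_sum has_derivative_mult_right has_derivative_prod G)
  moreover have "(\<Sum>p | p permutes UNIV. of_int (sign p) *
      (\<Sum>i\<in>UNIV. D i (p i) v * (\<Prod>j\<in>UNIV - {i}. G x $ j $ p j)))
    = det (G x) * (\<Sum>i\<in>UNIV. \<Sum>j\<in>UNIV. metric_inv (G x) i j * D i j v)" for v
  proof -
    \<comment> \<open>Row \<open>i\<close> of \<open>D A\<^sup>-\<^sup>1\<close>, for \<open>A = G x\<close>.\<close>
    define b where "b = (\<lambda>i. \<chi> k. \<Sum>j\<in>UNIV. metric_inv (G x) k j * D i j v)"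
    have row: "(\<Sum>k\<in>UNIV. b i $ k *s row k (G x)) = (\<chi> j. D i j v)" for i
    proof -
      have "(\<Sum>k\<in>UNIV. b i $ k * G x $ k $ l) = D i l v" for l
      proof -
        have "(\<Sum>k\<in>UNIV. b i $ k * G x $ k $ l)
            = (\<Sum>k\<in>UNIV. \<Sum>j\<in>UNIV. D i j v * (metric_inv (G x) k j * G x $ k $ l))"
          by (simp add: b_def sum_distrib_left sum_distrib_right mult_ac)
        also have "\<dots> = (\<Sum>j\<in>UNIV. D i j v * (\<Sum>k\<in>UNIV. metric_inv (G x) k j * G x $ k $ l))"
          by (subst sum.swap) (simp add: sum_distrib_left)
        also have "\<dots> = D i l v"
          by (simp add: metric_inv_right [OF det] if_distrib cong: if_cong)
        finally show ?thesis .
      qed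
      then show ?thesis by (simp add: vec_eq_iff row_def)
    qed
    have "(\<Sum>p | p permutes UNIV. of_int (sign p) *
        (\<Sum>i\<in>UNIV. D i (p i) v * (\<Prod>j\<in>UNIV - {i}. G x $ j $ p j)))
      = (\<Sum>i\<in>UNIV. \<Sum>p | p permutes UNIV. of_int (sign p) *
          (D i (p i) v * (\<Prod>j\<in>UNIV - {i}. G x $ j $ p j)))"
      unfolding sum_distrib_left by (rule sum.swap)
    also have "\<dots> = (\<Sum>i\<in>UNIV. det (\<chi> r. if r = i then (\<chi> j. D i j v) else row r (G x)))"
    proof (rule sum.cong [OF refl], unfold det_def, rule sum.cong [OF refl], rule arg_cong2 [where f = "(*)"])
      fix i :: 'n and p :: "'n \<Rightarrow> 'n"
      have "(\<Prod>r\<in>UNIV. (\<chi> r. if r = i then (\<chi> j. D i j v) else row r (G x)) $ r $ p r)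
        = D i (p i) v * (\<Prod>r\<in>UNIV - {i}. (\<chi> r. if r = i then (\<chi> j. D i j v) else row r (G x)) $ r $ p r)"
        by (subst prod.remove [of UNIV i]) auto
      also have "\<dots> = D i (p i) v * (\<Prod>r\<in>UNIV - {i}. G x $ r $ p r)"
        by (intro arg_cong2 [where f = "(*)"] prod.cong) (auto simp: row_def)
      finally show "D i (p i) v * (\<Prod>j\<in>UNIV - {i}. G x $ j $ p j)
        = (\<Prod>r\<in>UNIV. (\<chi> r. if r = i then (\<chi> j. D i j v) else row r (G x)) $ r $ p r)" ..
    qed auto
    also have "\<dots> = (\<Sum>i\<in>UNIV. b i $ i * det (G x))"
      unfolding row [symmetric] cramer_lemma_transpose ..
    also have "\<dots> = det (G x) * (\<Sum>i\<in>UNIV. \<Sum>j\<in>UNIV. metric_inv (G x) i j * D i j v)"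
      by (simp add: b_def sum_distrib_left mult.commute)
    finally show ?thesis .
  qed
  ultimately show ?thesis by simp
qed

section \<open>Positive definite Hermitian matrices\<close>

lemma hermitian_form_add:
  "hermitian_form A (X + X') Y = hermitian_form A X Y + hermitian_form A X' Y"
  "hermitian_form A X (Y + Y') = hermitian_form A X Y + hermitian_form A X Y'"
  by (simp_all add: hermitian_form_def algebra_simps sum.distrib)

lemma hermitian_form_scale:
  "hermitian_form A (a *s X) Y = a * hermitian_form A X Y"
  "hermitian_form A X (a *s Y) = cnj a * hermitian_form A X Y"
  by (simp_all add: hermitian_form_def algebra_simps sum_distrib_left)

lemma hermitian_form_axis: "hermitian_form A (axis i 1) (axis j 1) = A $ i $ j"
  by (simp add: hermitian_form_def axis_def if_distrib [of cnj] mult_delta_left mult_delta_right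
    cong: if_cong)

lemma hermitian_form_zero [simp]: "hermitian_form A 0 Y = 0" "hermitian_form A X 0 = 0"
  by (simp_all add: hermitian_form_def)

text \<open>
  The values at \<open>e\<^sub>i + e\<^sub>j\<close> and at \<open>e\<^sub>i + \<i> e\<^sub>j\<close> give the sum and the difference of the entries
  \<open>(i, j)\<close> and \<open>(j, i)\<close>.
\<close>

lemma hermitian_form_eq_0_imp:
  assumes "\<And>X. hermitian_form A X X = 0"
  shows "A $ i $ j = 0"
proof -
  define a b where "a = hermitian_form A (axis i 1) (axis j 1)"
    and "b = hermitian_form A (axis j 1) (axis i 1)"
  have "a + b = 0"
    using assms [of "axis i 1 + axis j 1"] assms [of "axis i 1"] assms [of "axis j 1"]
    by (simp add: hermitian_form_add a_def b_def add.commute)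
  moreover have "- (\<i> * a) + \<i> * b = 0"
    using assms [of "axis i 1 + \<i> *s axis j 1"] assms [of "axis i 1"] assms [of "axis j 1"]
    by (simp add: hermitian_form_add hermitian_form_scale a_def b_def)
  then have "b = a" by simp
  ultimately show ?thesis by (simp add: a_def hermitian_form_axis)
qed

lemma hermitian_pos_def_det_nonzero:
  assumes "hermitian_pos_def A"
  shows "det A \<noteq> 0"
proof
  assume "det A = 0"
  then have "det (transpose A) = 0" by simp
  then have "\<not> invertible (transpose A)" by (simp add: invertible_det_nz)
  then obtain X where X: "X \<noteq> 0" "transpose A *v X = 0"
    by (metis invertible_left_inverse matrix_left_invertible_ker)
  have "hermitian_form A X X = (\<Sum>j\<in>UNIV. (transpose A *v X) $ j * cnj (X $ j))"
    unfolding hermitian_form_def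
    by (subst sum.swap) (simp add: matrix_vector_mult_def transpose_def sum_distrib_right)
  also have "\<dots> = 0" using X by (simp del: transpose_matrix_vector)
  finally have "hermitian_form A X X = 0" .
  moreover have "Re (hermitian_form A X X) > 0" using X assms unfolding hermitian_pos_def_def by blast
  ultimately show False by simp
qed

lemma hermitian_det_real:
  assumes "\<And>i j. A $ j $ i = cnj (A $ i $ j)"
  shows "Im (det A) = 0"
proof -
  have "cnj (det A) = det (\<chi> i j. cnj (A $ i $ j))"
    unfolding det_def by simp
  also have "(\<chi> i j. cnj (A $ i $ j)) = transpose A"
    by (simp add: vec_eq_iff transpose_def assms [symmetric])
  finally have "cnj (det A) = det A" by simp
  then show ?thesis by (simp add: complex_eq_iff)
qed

text \<open>
  The segment from the identity to \<open>A\<close> consists of positive definite matrices, along which the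
  determinant is real and never zero; it starts at 1 and hence stays positive.
\<close>

lemma hermitian_pos_def_det_pos:
  fixes A :: "complex^'n^'n"
  assumes "hermitian_pos_def A"
  shows "Re (det A) > 0" "Im (det A) = 0"
proof -
  have herm: "A $ j $ i = cnj (A $ i $ j)" for i j
    using assms unfolding hermitian_pos_def_def by blast
  show "Im (det A) = 0" by (rule hermitian_det_real [OF herm])
  define P where "P = (\<lambda>t::real. \<chi> i j. of_real (1 - t) * (mat 1 :: complex^'n^'n) $ i $ j + of_real t * A $ i $ j)"
  have form: "hermitian_form (P t) X X
      = of_real (1 - t) * hermitian_form (mat 1) X X + of_real t * hermitian_form A X X" for t X
    by (simp add: hermitian_form_def P_def sum_distrib_left sum_subtractf sum.distrib algebra_simps)
  have one: "Re (hermitian_form (mat 1) X X) > 0" if nz: "X \<noteq> 0" for X :: "complex^'n"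
  proof -
    have "hermitian_form (mat 1) X X = (\<Sum>i\<in>UNIV. of_real ((cmod (X $ i))\<^sup>2))"
      by (simp add: hermitian_form_def mat_def if_distrib if_distribR complex_norm_square
        del: of_real_power cong: if_cong)
    then have "Re (hermitian_form (mat 1) X X) = (\<Sum>i\<in>UNIV. (cmod (X $ i))\<^sup>2)" by simp
    moreover obtain i where "X $ i \<noteq> 0" using nz by (auto simp: vec_eq_iff)
    ultimately show ?thesis by (simp add: sum_pos2 [of UNIV i])
  qed
  have pd: "hermitian_pos_def (P t)" if "0 \<le> t" "t \<le> 1" for t
    unfolding hermitian_pos_def_def
  proof (intro conjI allI impI)
    show "P t $ j $ i = cnj (P t $ i $ j)" for i j
      by (simp add: P_def mat_def herm [symmetric])
  next
    fix X :: "complex^'n" assume X: "X \<noteq> 0"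
    have "Re (hermitian_form A X X) > 0" using assms X unfolding hermitian_pos_def_def by blast
    then have "(1 - t) * Re (hermitian_form (mat 1) X X) + t * Re (hermitian_form A X X) > 0"
      using one [OF X] that
      by (cases "t = 0") (auto intro!: add_nonneg_pos)
    then show "Re (hermitian_form (P t) X X) > 0" by (simp add: form)
  qed
  have nz: "Re (det (P t)) \<noteq> 0" if "0 \<le> t" "t \<le> 1" for t
  proof -
    have "Im (det (P t)) = 0"
      using hermitian_det_real pd [OF that] unfolding hermitian_pos_def_def by blast
    then show ?thesis
      using hermitian_pos_def_det_nonzero [OF pd [OF that]] by (auto simp: complex_eq_iff)
  qed
  have cont: "continuous_on {0..1} (\<lambda>t. Re (det (P t)))"
    unfolding det_def P_def by (auto intro!: continuous_intros)
  have P0: "P 0 = mat 1" and P1: "P 1 = A" by (simp_all add: P_def vec_eq_iff)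
  show "Re (det A) > 0"
  proof (rule ccontr)
    assume "\<not> Re (det A) > 0"
    then obtain t where "0 \<le> t" "t \<le> 1" "Re (det (P t)) = 0"
      using IVT2' [OF _ _ _ cont, of 0] by (auto simp: P0 P1)
    then show False using nz by blast
  qed
qed

section \<open>Polarization of the curvature identity\<close>

lemma hermitian_form_matrix_add:
  "hermitian_form (\<chi> i j. A i j + B i j) X Y
    = hermitian_form (\<chi> i j. A i j) X Y + hermitian_form (\<chi> i j. B i j) X Y"
  by (simp add: hermitian_form_def algebra_simps sum.distrib)

lemma hermitian_form_matrix_scale:
  "hermitian_form (\<chi> i j. a * A i j) X Y = a * hermitian_form (\<chi> i j. A i j) X Y"
  by (simp add: hermitian_form_def algebra_simps sum_distrib_left)

text \<open>
  Let \<open>B(X,Y,Z,W)\<close> be the associated form, linear in \<open>X\<close>, \<open>Z\<close> and conjugate linear in \<open>Y\<close>, \<open>W\<close>.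
  Averaging \<open>B\<close> at \<open>X + t Y\<close> over the fourth roots of unity \<open>t\<close> keeps exactly the terms with as
  many factors \<open>t\<close> as conjugates of \<open>t\<close>. Apart from the two diagonal ones, they all equal
  \<open>B(X,X,Y,Y)\<close> by symmetry, so this vanishes. What remains is sesquilinear in each pair of
  arguments, and two applications of \<open>hermitian_form_eq_0_imp\<close> finish the proof.
\<close>

lemma symmetric_biquadratic_eq_0_imp:
  fixes T :: "'n::finite \<Rightarrow> 'n \<Rightarrow> 'n \<Rightarrow> 'n \<Rightarrow> complex"
  assumes sym1: "\<And>i j k l. T i j k l = T k j i l" and sym2: "\<And>i j k l. T i j k l = T i l k j"
    and zero: "\<And>X. (\<Sum>i\<in>UNIV. \<Sum>j\<in>UNIV. \<Sum>k\<in>UNIV. \<Sum>l\<in>UNIV.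
        T i j k l * X $ i * cnj (X $ j) * X $ k * cnj (X $ l)) = 0"
  shows "T i j k l = 0"
proof -
  define B where "B = (\<lambda>X Y Z W. hermitian_form (\<chi> i j. hermitian_form (\<chi> k l. T i j k l) Z W) X Y)"
  have B_eq: "B X Y Z W = (\<Sum>i\<in>UNIV. \<Sum>j\<in>UNIV. \<Sum>k\<in>UNIV. \<Sum>l\<in>UNIV.
      T i j k l * X $ i * cnj (Y $ j) * Z $ k * cnj (W $ l))" for X Y Z W
    by (simp add: B_def hermitian_form_def sum_distrib_left sum_distrib_right mult_ac)
  have add: "B (X + X') Y Z W = B X Y Z W + B X' Y Z W" "B X (Y + Y') Z W = B X Y Z W + B X Y' Z W"
    "B X Y (Z + Z') W = B X Y Z W + B X Y Z' W" "B X Y Z (W + W') = B X Y Z W + B X Y Z W'"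
    for X X' Y Y' Z Z' W W'
    by (simp_all add: B_def hermitian_form_add hermitian_form_matrix_add)
  have scale: "B (a *s X) Y Z W = a * B X Y Z W" "B X (a *s Y) Z W = cnj a * B X Y Z W"
    "B X Y (a *s Z) W = a * B X Y Z W" "B X Y Z (a *s W) = cnj a * B X Y Z W" for a X Y Z W
    by (simp_all add: B_def hermitian_form_scale hermitian_form_matrix_scale)
  have swap1: "B X Y Z W = B Z Y X W" for X Y Z W
  proof -
    have "B X Y Z W = (\<Sum>i\<in>UNIV. \<Sum>k\<in>UNIV. \<Sum>j\<in>UNIV. \<Sum>l\<in>UNIV.
        T i j k l * X $ i * cnj (Y $ j) * Z $ k * cnj (W $ l))"
      unfolding B_eq by (rule sum.cong [OF refl], rule sum.swap)
    also have "\<dots> = (\<Sum>k\<in>UNIV. \<Sum>i\<in>UNIV. \<Sum>j\<in>UNIV. \<Sum>l\<in>UNIV.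
        T i j k l * X $ i * cnj (Y $ j) * Z $ k * cnj (W $ l))"
      by (rule sum.swap)
    also have "\<dots> = (\<Sum>k\<in>UNIV. \<Sum>i\<in>UNIV. \<Sum>j\<in>UNIV. \<Sum>l\<in>UNIV.
        T k j i l * Z $ k * cnj (Y $ j) * X $ i * cnj (W $ l))"
      by (intro sum.cong refl) (subst sym1, simp add: mult_ac)
    also have "\<dots> = B Z Y X W"
      unfolding B_eq by (rule sum.cong [OF refl], rule sum.swap)
    finally show ?thesis .
  qed
  have swap2: "B X Y Z W = B X W Z Y" for X Y Z W
  proof -
    have "(\<Sum>j\<in>UNIV. \<Sum>k\<in>UNIV. \<Sum>l\<in>UNIV. T i j k l * X $ i * cnj (Y $ j) * Z $ k * cnj (W $ l))
      = (\<Sum>j\<in>UNIV. \<Sum>k\<in>UNIV. \<Sum>l\<in>UNIV. T i j k l * X $ i * cnj (W $ j) * Z $ k * cnj (Y $ l))"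
      for i
    proof -
      have "(\<Sum>j\<in>UNIV. \<Sum>k\<in>UNIV. \<Sum>l\<in>UNIV. T i j k l * X $ i * cnj (Y $ j) * Z $ k * cnj (W $ l))
        = (\<Sum>k\<in>UNIV. \<Sum>j\<in>UNIV. \<Sum>l\<in>UNIV. T i j k l * X $ i * cnj (Y $ j) * Z $ k * cnj (W $ l))"
        by (rule sum.swap)
      also have "\<dots> = (\<Sum>k\<in>UNIV. \<Sum>l\<in>UNIV. \<Sum>j\<in>UNIV. T i j k l * X $ i * cnj (Y $ j) * Z $ k * cnj (W $ l))"
        by (rule sum.cong [OF refl], rule sum.swap)
      also have "\<dots> = (\<Sum>k\<in>UNIV. \<Sum>l\<in>UNIV. \<Sum>j\<in>UNIV. T i l k j * X $ i * cnj (W $ l) * Z $ k * cnj (Y $ j))"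
        by (intro sum.cong refl) (subst sym2, simp add: mult_ac)
      also have "\<dots> = (\<Sum>l\<in>UNIV. \<Sum>k\<in>UNIV. \<Sum>j\<in>UNIV. T i l k j * X $ i * cnj (W $ l) * Z $ k * cnj (Y $ j))"
        by (rule sum.swap)
      finally show ?thesis .
    qed
    then show ?thesis unfolding B_eq by simp
  qed
  have diag: "B X X X X = 0" for X
    using zero by (simp add: B_eq)
  have mixed: "B X X Y Y = 0" for X Y
  proof -
    let ?F = "\<lambda>t. B (X + t *s Y) (X + t *s Y) (X + t *s Y) (X + t *s Y)"
    have "?F 1 + ?F (-1) + ?F \<i> + ?F (-\<i>)
        = 4 * (B X X X X + B X X Y Y + B X Y Y X + B Y X X Y + B Y Y X X + B Y Y Y Y)"
      by (simp only: add scale) (simp add: algebra_simps)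
    \<comment> \<open>The two diagonal terms vanish by hypothesis.\<close>
    then have "4 * (B X X Y Y + B X Y Y X + B Y X X Y + B Y Y X X) = 0"
      by (simp add: diag)
    then have "B X X Y Y + B X Y Y X + B Y X X Y + B Y Y X X = 0"
      unfolding mult_eq_0_iff by simp
    moreover have "B X Y Y X = B X X Y Y" by (rule swap2)
    moreover have "B Y X X Y = B X X Y Y" by (rule swap1)
    moreover have "B Y Y X X = B X X Y Y" using swap1 [of Y Y X X] swap2 [of X Y Y X] by simp
    ultimately show ?thesis by simp
  qed
  have "hermitian_form (\<chi> k l. T i j k l) Y Y = 0" for i j Y
    using hermitian_form_eq_0_imp [of "\<chi> i j. hermitian_form (\<chi> k l. T i j k l) Y Y" i j] mixed
    by (simp add: B_def)
  then show ?thesis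
    using hermitian_form_eq_0_imp [of "\<chi> k l. T i j k l" k l] by simp
qed

text \<open>
  The two ways in which the trace with the inverse metric contracts a tensor with the metric in
  only one of the traced indices: on the second index here, on the first index in the next lemma.
\<close>

lemma trace_times_metric_right:
  fixes H G :: "'n::finite \<Rightarrow> 'n \<Rightarrow> complex" and r :: "'n \<Rightarrow> complex"
  assumes "\<And>p k. (\<Sum>q\<in>UNIV. H p q * G k q) = (if p = k then 1 else 0)"
  shows "(\<Sum>k\<in>UNIV. \<Sum>l\<in>UNIV. H k l * (r k * G i l)) = r i"
proof -
  have "(\<Sum>k\<in>UNIV. \<Sum>l\<in>UNIV. H k l * (r k * G i l)) = (\<Sum>k\<in>UNIV. r k * (\<Sum>l\<in>UNIV. H k l * G i l))"
    by (simp add: sum_distrib_left mult_ac)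
  then show ?thesis by (simp add: assms mult_delta_right)
qed

lemma trace_times_metric_left:
  fixes H G :: "'n::finite \<Rightarrow> 'n \<Rightarrow> complex" and r :: "'n \<Rightarrow> complex"
  assumes "\<And>q l. (\<Sum>p\<in>UNIV. H p q * G p l) = (if q = l then 1 else 0)"
  shows "(\<Sum>k\<in>UNIV. \<Sum>l\<in>UNIV. H k l * (r l * G k j)) = r j"
proof -
  have "(\<Sum>k\<in>UNIV. \<Sum>l\<in>UNIV. H k l * (r l * G k j)) = (\<Sum>l\<in>UNIV. r l * (\<Sum>k\<in>UNIV. H k l * G k j))"
    by (subst sum.swap) (simp add: sum_distrib_left mult_ac)
  then show ?thesis by (simp add: assms mult_delta_right)
qed

text \<open>
  The coefficients \<open>T\<close> below are four times the symmetrization of those of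
  \<open>\<alpha> Ric(X,X) |X|\<^sup>2 + \<beta> R(X,X,X,X) - c |X|\<^sup>4\<close>. They vanish by polarization, and the conclusion
  follows by tracing once and then once more.
\<close>

lemma ricci_proportional_of_constant_mixed:
  fixes G :: "complex^'n::finite^'n" and R :: "'n \<Rightarrow> 'n \<Rightarrow> 'n \<Rightarrow> 'n \<Rightarrow> complex"
  assumes det: "det G \<noteq> 0"
    and sym1: "\<And>i j k l. R i j k l = R k j i l" and sym2: "\<And>i j k l. R i j k l = R i l k j"
    and Ric: "\<And>i j. Ric i j = (\<Sum>k\<in>UNIV. \<Sum>l\<in>UNIV. metric_inv G k l * R i j k l)"
    and const: "\<And>X. \<alpha> * hermitian_form (\<chi> i j. Ric i j) X X * hermitian_form G X X
      + \<beta> * (\<Sum>i\<in>UNIV. \<Sum>j\<in>UNIV. \<Sum>k\<in>UNIV. \<Sum>l\<in>UNIV.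
          R i j k l * X $ i * cnj (X $ j) * X $ k * cnj (X $ l))
      = c * (hermitian_form G X X)\<^sup>2"
    and nondeg: "(of_nat CARD('n) + 2) * \<alpha> + 4 * \<beta> \<noteq> 0"
  shows "((of_nat CARD('n) + 1) * \<alpha> + 2 * \<beta>) * Ric i j = c * (of_nat CARD('n) + 1) * G $ i $ j"
proof -
  let ?n = "of_nat CARD('n) :: complex"
  define H where "H = metric_inv G"
  have left: "(\<Sum>q\<in>UNIV. H p q * G $ k $ q) = (if p = k then 1 else 0)" for p k
    using metric_inv_left [OF det] by (simp add: H_def)
  have right: "(\<Sum>p\<in>UNIV. H p q * G $ p $ l) = (if q = l then 1 else 0)" for q l
    using metric_inv_right [OF det] by (simp add: H_def)
  define T where "T = (\<lambda>i j k l. \<alpha> * (Ric i j * G $ k $ l + Ric k l * G $ i $ j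
      + Ric k j * G $ i $ l + Ric i l * G $ k $ j)
    + 4 * \<beta> * R i j k l - 2 * c * (G $ i $ j * G $ k $ l + G $ k $ j * G $ i $ l))"
  have T0: "T i j k l = 0" for i j k l
  proof (rule symmetric_biquadratic_eq_0_imp)
    show "T i j k l = T k j i l" for i j k l
      using sym1 [of i j k l] by (simp add: T_def algebra_simps)
    show "T i j k l = T i l k j" for i j k l
      using sym2 [of i j k l] by (simp add: T_def algebra_simps)
  next
    fix X :: "complex^'n"
    define S where "S = (\<lambda>A :: 'n \<Rightarrow> 'n \<Rightarrow> 'n \<Rightarrow> 'n \<Rightarrow> complex.
      \<Sum>i\<in>UNIV. \<Sum>j\<in>UNIV. \<Sum>k\<in>UNIV. \<Sum>l\<in>UNIV. A i j k l * X $ i * cnj (X $ j) * X $ k * cnj (X $ l))"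
    have S_add: "S (\<lambda>i j k l. A i j k l + B i j k l) = S A + S B" for A B
      by (simp add: S_def algebra_simps sum.distrib)
    have S_scale: "S (\<lambda>i j k l. a * A i j k l) = a * S A" for A a
      by (simp add: S_def algebra_simps sum_distrib_left)
    have S_1: "S (\<lambda>i j k l. A i j * B k l) = hermitian_form (\<chi> i j. A i j) X X * hermitian_form (\<chi> i j. B i j) X X" for A B
    proof -
      have first: "hermitian_form (\<chi> i j. A i j) X X * h = (\<Sum>i\<in>UNIV. \<Sum>j\<in>UNIV. A i j * X $ i * cnj (X $ j) * h)" for h
        by (simp add: hermitian_form_def sum_distrib_right)
      show ?thesis
        unfolding first by (simp add: S_def hermitian_form_def sum_distrib_left mult_ac)
    qed
    have S_swap: "S A = S (\<lambda>i j k l. A i l k j)" for A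
    proof -
      have "S A = (\<Sum>i\<in>UNIV. \<Sum>j\<in>UNIV. \<Sum>l\<in>UNIV. \<Sum>k\<in>UNIV. A i j k l * X $ i * cnj (X $ j) * X $ k * cnj (X $ l))"
        unfolding S_def by (intro sum.cong refl sum.swap)
      also have "\<dots> = (\<Sum>i\<in>UNIV. \<Sum>l\<in>UNIV. \<Sum>j\<in>UNIV. \<Sum>k\<in>UNIV. A i j k l * X $ i * cnj (X $ j) * X $ k * cnj (X $ l))"
        by (intro sum.cong refl sum.swap)
      also have "\<dots> = (\<Sum>i\<in>UNIV. \<Sum>l\<in>UNIV. \<Sum>k\<in>UNIV. \<Sum>j\<in>UNIV. A i j k l * X $ i * cnj (X $ j) * X $ k * cnj (X $ l))"
        by (intro sum.cong refl sum.swap)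
      finally show ?thesis by (simp add: S_def mult_ac)
    qed
    let ?r = "hermitian_form (\<chi> i j. Ric i j) X X" and ?g = "hermitian_form G X X"
    have G: "hermitian_form (\<chi> i j. G $ i $ j) X X = ?g" by simp
    have "S T = \<alpha> * (S (\<lambda>i j k l. Ric i j * G $ k $ l) + S (\<lambda>i j k l. G $ i $ j * Ric k l)
        + S (\<lambda>i j k l. G $ i $ l * Ric k j) + S (\<lambda>i j k l. Ric i l * G $ k $ j))
      + 4 * \<beta> * S R + (- 2 * c) * (S (\<lambda>i j k l. G $ i $ j * G $ k $ l) + S (\<lambda>i j k l. G $ i $ l * G $ k $ j))"
      unfolding S_add [symmetric] S_scale [symmetric] by (simp add: T_def algebra_simps)
    also have "\<dots> = 4 * (\<alpha> * ?r * ?g + \<beta> * S R - c * ?g\<^sup>2)"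
      unfolding S_swap [of "\<lambda>i j k l. G $ i $ l * _ k j"] S_swap [of "\<lambda>i j k l. Ric i l * G $ k $ j"] S_1 G
      by (simp add: algebra_simps power2_eq_square)
    also have "\<dots> = 0" using const [of X] by (simp add: S_def)
    finally show "(\<Sum>i\<in>UNIV. \<Sum>j\<in>UNIV. \<Sum>k\<in>UNIV. \<Sum>l\<in>UNIV.
        T i j k l * X $ i * cnj (X $ j) * X $ k * cnj (X $ l)) = 0"
      by (simp add: S_def)
  qed
  define tr where "tr = (\<lambda>A :: 'n \<Rightarrow> 'n \<Rightarrow> complex. \<Sum>k\<in>UNIV. \<Sum>l\<in>UNIV. H k l * A k l)"
  have tr_add: "tr (\<lambda>k l. A k l + B k l) = tr A + tr B" for A B
    by (simp add: tr_def algebra_simps sum.distrib)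
  have tr_scale: "tr (\<lambda>k l. a * A k l) = a * tr A" for A a
    by (simp add: tr_def algebra_simps sum_distrib_left)
  have tr_G: "tr (\<lambda>k l. G $ k $ l) = ?n"
    by (simp add: tr_def left)
  have tr_1: "tr (\<lambda>k l. A k * G $ i $ l) = A i" for A i
    unfolding tr_def by (rule trace_times_metric_right [OF left])
  have tr_2: "tr (\<lambda>k l. A l * G $ k $ j) = A j" for A j
    unfolding tr_def by (rule trace_times_metric_left [OF right])
  define s where "s = tr Ric"
  have Ric_tr: "tr (R i j) = Ric i j" for i j
    by (simp add: tr_def Ric H_def)
  have once: "((?n + 2) * \<alpha> + 4 * \<beta>) * Ric i j = (2 * c * (?n + 1) - \<alpha> * s) * G $ i $ j" for i j
  proof -
    have "0 = tr (\<lambda>k l. T i j k l)" by (simp add: T0 tr_def)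
    also have "\<dots> = \<alpha> * (Ric i j * tr (\<lambda>k l. G $ k $ l) + G $ i $ j * tr Ric
        + tr (\<lambda>k l. Ric k j * G $ i $ l) + tr (\<lambda>k l. Ric i l * G $ k $ j))
      + 4 * \<beta> * tr (R i j) + (- 2 * c) * (G $ i $ j * tr (\<lambda>k l. G $ k $ l) + tr (\<lambda>k l. G $ k $ j * G $ i $ l))"
      unfolding tr_add [symmetric] tr_scale [symmetric] by (simp add: T_def algebra_simps)
    also have "\<dots> = \<alpha> * (Ric i j * ?n + G $ i $ j * s + Ric i j + Ric i j) + 4 * \<beta> * Ric i j
        + (- 2 * c) * (G $ i $ j * ?n + G $ i $ j)"
      by (simp only: tr_1 [of "\<lambda>k. Ric k j"] tr_1 [of "\<lambda>k. G $ k $ j"] tr_2 tr_G Ric_tr s_def)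
    finally show ?thesis by (simp add: algebra_simps)
  qed
  have "((?n + 2) * \<alpha> + 4 * \<beta>) * s = (2 * c * (?n + 1) - \<alpha> * s) * ?n"
    unfolding s_def tr_scale [symmetric] once
    by (simp add: tr_scale tr_G s_def)
  then have "2 * (((?n + 1) * \<alpha> + 2 * \<beta>) * s) = 2 * (c * (?n + 1) * ?n)"
    by (simp add: algebra_simps)
  then have s: "((?n + 1) * \<alpha> + 2 * \<beta>) * s = c * (?n + 1) * ?n"
    unfolding mult_cancel_left by simp
  let ?\<mu> = "(?n + 2) * \<alpha> + 4 * \<beta>" and ?\<nu> = "(?n + 1) * \<alpha> + 2 * \<beta>"
  have "?\<mu> * (?\<nu> * Ric i j) = ?\<nu> * ((2 * c * (?n + 1) - \<alpha> * s) * G $ i $ j)"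
    unfolding once [symmetric] by (rule mult.left_commute)
  also have "\<dots> = (2 * c * (?n + 1) * ?\<nu> - \<alpha> * (?\<nu> * s)) * G $ i $ j"
    by (simp add: algebra_simps)
  also have "\<dots> = ?\<mu> * (c * (?n + 1) * G $ i $ j)"
    unfolding s by (simp add: algebra_simps)
  finally show ?thesis using nondeg by simp
qed

section \<open>Wirtinger derivatives\<close>

lemma d_dz_eq:
  "(f has_derivative D) (at z) \<Longrightarrow> d_dz i f z = (D (axis i 1) - \<i> * D (axis i \<i>)) / 2"
  by (simp add: d_dz_def frechet_derivative_eq)

lemma d_dzbar_eq:
  "(f has_derivative D) (at z) \<Longrightarrow> d_dzbar i f z = (D (axis i 1) + \<i> * D (axis i \<i>)) / 2"
  by (simp add: d_dzbar_def frechet_derivative_eq)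

lemma d_dz_transform:
  assumes "f differentiable (at z)" "open S" "z \<in> S" "\<And>x. x \<in> S \<Longrightarrow> f x = g x"
  shows "d_dz i f z = d_dz i g z"
  using frechet_derivative_transform_within_open [OF assms] by (simp add: d_dz_def)

lemma d_dz_mult:
  assumes "f differentiable (at z)" "g differentiable (at z)"
  shows "d_dz i (\<lambda>x. f x * g x) z = d_dz i f z * g z + f z * d_dz i g z"
  using d_dz_eq [OF has_derivative_mult [OF assms [unfolded frechet_derivative_works]], of i]
  by (simp add: d_dz_def algebra_simps add_divide_distrib diff_divide_distrib)

lemma d_dz_sum:
  assumes "\<And>k. k \<in> I \<Longrightarrow> f k differentiable (at z)"
  shows "d_dz i (\<lambda>x. \<Sum>k\<in>I. f k x) z = (\<Sum>k\<in>I. d_dz i (f k) z)"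
proof -
  have "((\<lambda>x. \<Sum>k\<in>I. f k x) has_derivative (\<lambda>v. \<Sum>k\<in>I. frechet_derivative (f k) (at z) v)) (at z)"
    using assms by (intro has_derivative_sum) (simp flip: frechet_derivative_works)
  from d_dz_eq [OF this, of i] show ?thesis
    by (simp add: d_dz_def sum_subtractf sum_distrib_left flip: sum_divide_distrib)
qed

lemma d_dz_const: "d_dz i (\<lambda>x. c) z = 0"
  by (simp add: d_dz_def)

lemma d_dz_cmult:
  assumes "f differentiable (at z)"
  shows "d_dz i (\<lambda>x. c * f x) z = c * d_dz i f z"
  using d_dz_mult [of "\<lambda>x. c" z f i] assms by (simp add: d_dz_const)

lemma smooth_on_d_dz:
  assumes "open S" "smooth_on f S"
  shows "smooth_on (d_dz i f) S"
proof -
  have "smooth_on (\<lambda>z. 1/2 * frechet_derivative f (at z) (axis i 1)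
      + (-\<i>/2) * frechet_derivative f (at z) (axis i \<i>)) S"
    by (intro smooth_on_add smooth_on_mult smooth_on_const smooth_on_frechet_derivative assms)
  then show ?thesis by (simp add: d_dz_def [abs_def] diff_divide_distrib)
qed

lemma smooth_on_d_dzbar:
  assumes "open S" "smooth_on f S"
  shows "smooth_on (d_dzbar i f) S"
proof -
  have "smooth_on (\<lambda>z. 1/2 * frechet_derivative f (at z) (axis i 1)
      + (\<i>/2) * frechet_derivative f (at z) (axis i \<i>)) S"
    by (intro smooth_on_add smooth_on_mult smooth_on_const smooth_on_frechet_derivative assms)
  then show ?thesis by (simp add: d_dzbar_def [abs_def] add_divide_distrib)
qed

lemma d_dz_commute:
  assumes "smooth_on f S" "open S" "z \<in> S"
  shows "d_dz i (d_dz j f) z = d_dz j (d_dz i f) z"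
proof -
  let ?F = "\<lambda>v x. frechet_derivative f (at x) v"
  have "(?F v has_derivative frechet_derivative (?F v) (at z)) (at z)" for v
    using smooth_on_has_derivative smooth_on_frechet_derivative assms by blast
  then have "(d_dz j f has_derivative (\<lambda>v. (frechet_derivative (?F (axis j 1)) (at z) v
      - \<i> * frechet_derivative (?F (axis j \<i>)) (at z) v) / 2)) (at z)" for j
    unfolding d_dz_def [abs_def]
    by (intro bounded_linear.has_derivative [OF bounded_linear_divide] has_derivative_diff
        has_derivative_mult_right)
  note D = d_dz_eq [OF this]
  show ?thesis
    unfolding D using second_derivative_symmetric [OF assms]
    by (simp add: algebra_simps diff_divide_distrib)
qed

text \<open>
  The decomposition \<open>df = \<partial>f + \<bar>\<partial>f\<close>.
\<close>

lemma frechet_derivative_wirtinger: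
  assumes "f differentiable (at z)"
  shows "frechet_derivative f (at z) u
    = (\<Sum>i\<in>UNIV. d_dz i f z * u $ i + d_dzbar i f z * cnj (u $ i))"
proof -
  define D where "D = frechet_derivative f (at z)"
  have lin: "linear D" unfolding D_def by (rule linear_frechet_derivative [OF assms])
  have "u = (\<Sum>i\<in>UNIV. Re (u $ i) *\<^sub>R axis i 1 + Im (u $ i) *\<^sub>R axis i \<i>)"
  proof (rule vec_eq_iff [THEN iffD2], rule allI)
    fix k
    have "(\<Sum>i\<in>UNIV. Re (u $ i) *\<^sub>R axis i 1 + Im (u $ i) *\<^sub>R axis i \<i>) $ k
        = (\<Sum>i\<in>UNIV. if i = k then u $ k else 0)"
      unfolding sum_component
      by (rule sum.cong [OF refl]) (auto simp: axis_def complex_eq_iff)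
    then show "u $ k = (\<Sum>i\<in>UNIV. Re (u $ i) *\<^sub>R axis i 1 + Im (u $ i) *\<^sub>R axis i \<i>) $ k"
      by simp
  qed
  then have "D u = D (\<Sum>i\<in>UNIV. Re (u $ i) *\<^sub>R axis i 1 + Im (u $ i) *\<^sub>R axis i \<i>)" by simp
  also have "\<dots> = (\<Sum>i\<in>UNIV. Re (u $ i) *\<^sub>R D (axis i 1) + Im (u $ i) *\<^sub>R D (axis i \<i>))"
    by (simp add: linear_sum [OF lin] linear_add [OF lin] linear_scale [OF lin])
  also have "\<dots> = (\<Sum>i\<in>UNIV. d_dz i f z * u $ i + d_dzbar i f z * cnj (u $ i))"
  proof (rule sum.cong [OF refl])
    fix i
    have "x *\<^sub>R a + y *\<^sub>R b = (a - \<i> * b) / 2 * Complex x y + (a + \<i> * b) / 2 * cnj (Complex x y)"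
      for a b x y
      by (simp add: complex_eq_iff field_simps)
    from this [of "Re (u $ i)" "D (axis i 1)" "Im (u $ i)" "D (axis i \<i>)"]
    show "Re (u $ i) *\<^sub>R D (axis i 1) + Im (u $ i) *\<^sub>R D (axis i \<i>)
        = d_dz i f z * u $ i + d_dzbar i f z * cnj (u $ i)"
      by (simp add: d_dz_def d_dzbar_def D_def)
  qed
  finally show ?thesis by (simp add: D_def)
qed

lemma d_dzbar_cnj:
  assumes "f differentiable (at z)"
  shows "d_dzbar i (\<lambda>x. cnj (f x)) z = cnj (d_dz i f z)"
  using frechet_derivative_bounded_linear [OF bounded_linear_cnj assms]
  by (simp add: d_dzbar_def d_dz_def)

section \<open>The Chern Ricci curvature as a trace of the Chern curvature\<close>

text \<open>
  The formula \<open>\<partial>(g\<^sup>-\<^sup>1) = - g\<^sup>-\<^sup>1 (\<partial>g) g\<^sup>-\<^sup>1\<close>, obtained by differentiating \<open>g\<^sup>-\<^sup>1 g = 1\<close>.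
\<close>

lemma d_dz_metric_inv:
  fixes G :: "complex^'n::finite \<Rightarrow> complex^'n^'n"
  assumes S: "open S" and z: "z \<in> S" and G: "smooth_on G S"
    and det: "\<And>x. x \<in> S \<Longrightarrow> det (G x) \<noteq> 0"
  shows "d_dz i (\<lambda>x. metric_inv (G x) p l) z
    = - (\<Sum>k\<in>UNIV. \<Sum>q\<in>UNIV. metric_inv (G z) k l * metric_inv (G z) p q * d_dz i (\<lambda>x. G x $ k $ q) z)"
proof -
  let ?H = "metric_inv (G z)" and ?dG = "\<lambda>k q. d_dz i (\<lambda>x. G x $ k $ q) z"
  let ?dH = "\<lambda>q. d_dz i (\<lambda>x. metric_inv (G x) p q) z"
  note sG = smooth_on_component2 [OF S G]
  note sH = smooth_on_metric_inv [OF S sG det]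
  note dG = smooth_on_differentiable [OF sG z] and dH = smooth_on_differentiable [OF sH z]
  have "(\<Sum>q\<in>UNIV. ?dH q * G z $ k $ q) = - (\<Sum>q\<in>UNIV. ?H p q * ?dG k q)" for k
  proof -
    have "d_dz i (\<lambda>x. \<Sum>q\<in>UNIV. metric_inv (G x) p q * G x $ k $ q) z = d_dz i (\<lambda>x. if p = k then 1 else 0) z"
    proof (rule d_dz_transform [OF _ S z])
      show "(\<lambda>x. \<Sum>q\<in>UNIV. metric_inv (G x) p q * G x $ k $ q) differentiable at z"
        by (rule smooth_on_differentiable [OF _ z]) (intro smooth_on_sum smooth_on_mult S sG sH)
    qed (rule metric_inv_left [OF det])
    then have "(\<Sum>q\<in>UNIV. ?dH q * G z $ k $ q + ?H p q * ?dG k q) = 0"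
      by (simp add: d_dz_sum d_dz_mult dG dH d_dz_const)
    then show ?thesis by (simp add: sum.distrib eq_neg_iff_add_eq_0)
  qed
  then have *: "(\<Sum>k\<in>UNIV. ?H k l * (\<Sum>q\<in>UNIV. ?dH q * G z $ k $ q))
      = - (\<Sum>k\<in>UNIV. \<Sum>q\<in>UNIV. ?H k l * ?H p q * ?dG k q)"
    by (simp add: sum_distrib_left sum_negf mult.assoc)
  have "(\<Sum>k\<in>UNIV. ?H k l * (\<Sum>q\<in>UNIV. ?dH q * G z $ k $ q))
      = (\<Sum>k\<in>UNIV. \<Sum>q\<in>UNIV. ?dH q * (?H k l * G z $ k $ q))"
    by (simp add: sum_distrib_left mult_ac)
  also have "\<dots> = (\<Sum>q\<in>UNIV. ?dH q * (\<Sum>k\<in>UNIV. ?H k l * G z $ k $ q))"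
    unfolding sum_distrib_left by (rule sum.swap)
  also have "\<dots> = ?dH l"
    by (simp add: metric_inv_right [OF det [OF z]] mult_delta_right)
  finally show ?thesis using * by simp
qed

text \<open>
  By Jacobi's formula \<open>\<partial>\<^bsub>\<bar>j\<^esub> log det g\<close> is the trace of \<open>g\<^sup>-\<^sup>1 \<partial>\<^bsub>\<bar>j\<^esub>g\<close>. When \<open>\<partial>\<^sub>i\<close> falls on the second
  factor it produces the second-order term of the curvature, and when it falls on \<open>g\<^sup>-\<^sup>1\<close> it produces
  the quadratic first-order term.
\<close>

lemma chern_ricci_eq_trace:
  fixes G :: "complex^'n::finite \<Rightarrow> complex^'n^'n"
  assumes S: "open S" and z: "z \<in> S" and G: "smooth_on G S"
    and det: "\<And>x. x \<in> S \<Longrightarrow> det (G x) \<notin> \<real>\<^sub>\<le>\<^sub>0"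
  shows "chern_ricci G z i j = (\<Sum>k\<in>UNIV. \<Sum>l\<in>UNIV. metric_inv (G z) k l * chern_curvature G z i j k l)"
proof -
  have nz: "det (G x) \<noteq> 0" if "x \<in> S" for x using det [OF that] by auto
  note sG = smooth_on_component2 [OF S G]
  note sH = smooth_on_metric_inv [OF S sG nz]
  note sbG = smooth_on_d_dzbar [OF S sG]
  note dH = smooth_on_differentiable [OF sH z] and dbG = smooth_on_differentiable [OF sbG z]
  let ?H = "metric_inv (G z)"
  define P where "P = (\<lambda>k l p q. ?H k l * ?H p q * d_dz i (\<lambda>x. G x $ k $ q) z * d_dzbar j (\<lambda>x. G x $ p $ l) z)"
  have log: "d_dzbar j (\<lambda>x. Ln (det (G x))) x
      = (\<Sum>k\<in>UNIV. \<Sum>l\<in>UNIV. metric_inv (G x) k l * d_dzbar j (\<lambda>x. G x $ k $ l) x)" if x: "x \<in> S" for x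
  proof -
    have "((\<lambda>x. Ln (det (G x))) has_derivative (\<lambda>v. inverse (det (G x)) * (det (G x) *
        (\<Sum>k\<in>UNIV. \<Sum>l\<in>UNIV. metric_inv (G x) k l * frechet_derivative (\<lambda>x. G x $ k $ l) (at x) v)))) (at x)"
      by (intro has_derivative_Ln_comp det_has_derivative smooth_on_has_derivative [OF sG x] det nz x)
    moreover have "inverse (det (G x)) * (det (G x) * s) = s" for s
      using nz [OF x] by (simp flip: mult.assoc)
    ultimately have "((\<lambda>x. Ln (det (G x))) has_derivative (\<lambda>v.
        \<Sum>k\<in>UNIV. \<Sum>l\<in>UNIV. metric_inv (G x) k l * frechet_derivative (\<lambda>x. G x $ k $ l) (at x) v)) (at x)"
      by (simp only:)
    from d_dzbar_eq [OF this] show ?thesis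
      by (simp add: d_dzbar_def sum_distrib_left sum.distrib algebra_simps add_divide_distrib sum_divide_distrib)
  qed
  have inv: "d_dz i (\<lambda>x. metric_inv (G x) p l) z
      = - (\<Sum>k\<in>UNIV. \<Sum>q\<in>UNIV. ?H k l * ?H p q * d_dz i (\<lambda>x. G x $ k $ q) z)" for p l
    by (rule d_dz_metric_inv [OF S z G nz])
  have "chern_ricci G z i j
      = - d_dz i (\<lambda>x. \<Sum>k\<in>UNIV. \<Sum>l\<in>UNIV. metric_inv (G x) k l * d_dzbar j (\<lambda>x. G x $ k $ l) x) z"
    unfolding chern_ricci_def
    by (intro arg_cong [where f = uminus] d_dz_transform [OF _ S z] log smooth_on_differentiable [OF _ z]
        smooth_on_d_dzbar smooth_on_Ln smooth_on_det sG S det)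
  also have "\<dots> = - (\<Sum>k\<in>UNIV. \<Sum>l\<in>UNIV. d_dz i (\<lambda>x. metric_inv (G x) k l) z * d_dzbar j (\<lambda>x. G x $ k $ l) z
      + ?H k l * d_dz i (d_dzbar j (\<lambda>x. G x $ k $ l)) z)"
    by (simp add: d_dz_sum d_dz_mult dH dbG)
  also have "\<dots> = (\<Sum>k\<in>UNIV. \<Sum>l\<in>UNIV. - ?H k l * d_dz i (d_dzbar j (\<lambda>x. G x $ k $ l)) z)
      + (\<Sum>p\<in>UNIV. \<Sum>l\<in>UNIV. \<Sum>k\<in>UNIV. \<Sum>q\<in>UNIV. P k l p q)"
    unfolding inv by (simp add: P_def sum.distrib sum_negf sum_subtractf sum_distrib_right)
  also have "(\<Sum>p\<in>UNIV. \<Sum>l\<in>UNIV. \<Sum>k\<in>UNIV. \<Sum>q\<in>UNIV. P k l p q)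
      = (\<Sum>p\<in>UNIV. \<Sum>k\<in>UNIV. \<Sum>l\<in>UNIV. \<Sum>q\<in>UNIV. P k l p q)"
    by (intro sum.cong refl sum.swap)
  also have "\<dots> = (\<Sum>k\<in>UNIV. \<Sum>p\<in>UNIV. \<Sum>l\<in>UNIV. \<Sum>q\<in>UNIV. P k l p q)"
    by (rule sum.swap)
  also have "\<dots> = (\<Sum>k\<in>UNIV. \<Sum>l\<in>UNIV. \<Sum>p\<in>UNIV. \<Sum>q\<in>UNIV. P k l p q)"
    by (intro sum.cong refl sum.swap)
  also have "(\<Sum>k\<in>UNIV. \<Sum>l\<in>UNIV. - ?H k l * d_dz i (d_dzbar j (\<lambda>x. G x $ k $ l)) z) + \<dots>
      = (\<Sum>k\<in>UNIV. \<Sum>l\<in>UNIV. ?H k l * chern_curvature G z i j k l)"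
    by (simp add: chern_curvature_def P_def sum.distrib sum_distrib_left algebra_simps sum_subtractf sum_negf)
  finally show ?thesis .
qed

section \<open>Closedness of the fundamental form\<close>

text \<open>
  The hypotheses are the vanishing of the (2,1) and of the (1,2) part of \<open>d\<omega>\<close>. In the proof, \<open>P\<close> and
  \<open>Q\<close> are the contributions of \<open>\<partial>\<close> and \<open>\<bar>\<partial>\<close> to the derivative of \<open>\<omega>\<close>; by the hypotheses each is
  symmetric in the two arguments of equal type, so the alternating sum cancels in pairs.
\<close>

lemma fundamental_form_closed:
  fixes G :: "complex^'n::finite \<Rightarrow> complex^'n^'n"
  assumes diff: "\<And>i j. (\<lambda>x. G x $ i $ j) differentiable (at z)"
    and dz: "\<And>i j k. d_dz i (\<lambda>x. G x $ j $ k) z = d_dz j (\<lambda>x. G x $ i $ k) z"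
    and dzbar: "\<And>i j k. d_dzbar i (\<lambda>x. G x $ j $ k) z = d_dzbar k (\<lambda>x. G x $ j $ i) z"
  shows "ext_deriv2 (fundamental_form G) z u v w = 0"
proof -
  define P where "P = (\<lambda>u v w :: complex^'n. \<Sum>i\<in>UNIV. \<Sum>j\<in>UNIV. \<Sum>k\<in>UNIV.
    d_dz k (\<lambda>x. G x $ i $ j) z * u $ k * v $ i * cnj (w $ j))"
  define Q where "Q = (\<lambda>u v w :: complex^'n. \<Sum>i\<in>UNIV. \<Sum>j\<in>UNIV. \<Sum>k\<in>UNIV.
    d_dzbar k (\<lambda>x. G x $ i $ j) z * cnj (u $ k) * v $ i * cnj (w $ j))"
  have P: "P u v w = P v u w" for u v w
  proof -
    have "P u v w = (\<Sum>j\<in>UNIV. \<Sum>i\<in>UNIV. \<Sum>k\<in>UNIV. d_dz k (\<lambda>x. G x $ i $ j) z * u $ k * v $ i * cnj (w $ j))"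
      unfolding P_def by (rule sum.swap)
    also have "\<dots> = (\<Sum>j\<in>UNIV. \<Sum>k\<in>UNIV. \<Sum>i\<in>UNIV. d_dz k (\<lambda>x. G x $ i $ j) z * u $ k * v $ i * cnj (w $ j))"
      by (intro sum.cong refl sum.swap)
    also have "\<dots> = (\<Sum>k\<in>UNIV. \<Sum>j\<in>UNIV. \<Sum>i\<in>UNIV. d_dz k (\<lambda>x. G x $ i $ j) z * u $ k * v $ i * cnj (w $ j))"
      by (rule sum.swap)
    also have "\<dots> = P v u w"
      unfolding P_def by (intro sum.cong refl) (subst dz, simp add: mult_ac)
    finally show ?thesis .
  qed
  have Q: "Q u v w = Q w v u" for u v w
  proof -
    have "Q u v w = (\<Sum>i\<in>UNIV. \<Sum>k\<in>UNIV. \<Sum>j\<in>UNIV. d_dzbar k (\<lambda>x. G x $ i $ j) z * cnj (u $ k) * v $ i * cnj (w $ j))"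
      unfolding Q_def by (intro sum.cong refl sum.swap)
    also have "\<dots> = Q w v u"
      unfolding Q_def by (intro sum.cong refl) (subst dzbar, simp add: mult_ac)
    finally show ?thesis .
  qed
  have D: "frechet_derivative (\<lambda>x. fundamental_form G x v w) (at z) u
    = \<i> * (P u v w - P u w v + Q u v w - Q u w v)" for u v w
  proof -
    have "((\<lambda>x. fundamental_form G x v w) has_derivative (\<lambda>u. \<i> * (\<Sum>i\<in>UNIV. \<Sum>j\<in>UNIV.
        frechet_derivative (\<lambda>x. G x $ i $ j) (at z) u * (v $ i * cnj (w $ j) - w $ i * cnj (v $ j))))) (at z)"
      unfolding fundamental_form_def
      by (intro has_derivative_mult_right has_derivative_mult_left has_derivative_sum
          diff [unfolded frechet_derivative_works])
    then have "frechet_derivative (\<lambda>x. fundamental_form G x v w) (at z) u = \<i> * (\<Sum>i\<in>UNIV. \<Sum>j\<in>UNIV.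
        frechet_derivative (\<lambda>x. G x $ i $ j) (at z) u * (v $ i * cnj (w $ j) - w $ i * cnj (v $ j)))"
      by (simp add: frechet_derivative_eq)
    also have "\<dots> = \<i> * (P u v w - P u w v + Q u v w - Q u w v)"
      unfolding frechet_derivative_wirtinger [OF diff] P_def Q_def
      by (simp add: algebra_simps sum_distrib_left sum_distrib_right sum.distrib sum_subtractf)
    finally show ?thesis .
  qed
  show ?thesis
    unfolding ext_deriv2_def D
    using P [of u v w] P [of u w v] P [of v w u] Q [of u v w] Q [of u w v] Q [of v u w]
    by (simp add: algebra_simps)
qed

text \<open>
  If \<open>g\<^bsub>j\<bar>k\<^esub> = - a \<partial>\<^sub>j h\<^sub>k\<close> with \<open>h\<^sub>k = \<partial>\<^bsub>\<bar>k\<^esub> log det g\<close>, then \<open>\<partial>\<^sub>i g\<^bsub>j\<bar>k\<^esub>\<close> is symmetric in \<open>i\<close> and \<open>j\<close>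
  because second derivatives of \<open>h\<^sub>k\<close> commute. That \<open>a\<close> is constant is essential here. The
  conjugate symmetry follows from \<open>g\<close> being Hermitian.
\<close>

lemma ricci_proportional_imp_closed:
  fixes G :: "complex^'n::finite \<Rightarrow> complex^'n^'n"
  assumes S: "open S" and z: "z \<in> S" and G: "smooth_on G S"
    and pd: "\<And>x. x \<in> S \<Longrightarrow> hermitian_pos_def (G x)"
    and einstein: "\<And>x i j. x \<in> S \<Longrightarrow> G x $ i $ j = a * chern_ricci G x i j"
  shows "ext_deriv2 (fundamental_form G) z u v w = 0"
proof (rule fundamental_form_closed)
  note sG = smooth_on_component2 [OF S G]
  have det: "det (G x) \<notin> \<real>\<^sub>\<le>\<^sub>0" if "x \<in> S" for x
    using hermitian_pos_def_det_pos [OF pd [OF that]] by (auto simp: complex_nonpos_Reals_iff)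
  define h where "h = (\<lambda>k. d_dzbar k (\<lambda>x. Ln (det (G x))))"
  have h: "smooth_on (h k) S" for k
    unfolding h_def by (intro smooth_on_d_dzbar smooth_on_Ln smooth_on_det S sG det)
  show diff: "(\<lambda>x. G x $ i $ j) differentiable (at z)" for i j
    by (rule smooth_on_differentiable [OF sG z])
  have eq: "d_dz i (\<lambda>x. G x $ j $ k) z = - a * d_dz i (d_dz j (h k)) z" for i j k
  proof -
    have "d_dz i (\<lambda>x. G x $ j $ k) z = d_dz i (\<lambda>x. - a * d_dz j (h k) x) z"
      by (rule d_dz_transform [OF diff S z]) (simp add: einstein chern_ricci_def h_def)
    also have "\<dots> = - a * d_dz i (d_dz j (h k)) z"
      by (rule d_dz_cmult [OF smooth_on_differentiable [OF smooth_on_d_dz [OF S h] z]])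
    finally show ?thesis .
  qed
  show dz: "d_dz i (\<lambda>x. G x $ j $ k) z = d_dz j (\<lambda>x. G x $ i $ k) z" for i j k
    unfolding eq by (subst d_dz_commute [OF h S z]) simp
  have bar: "d_dzbar i (\<lambda>x. G x $ j $ k) z = cnj (d_dz i (\<lambda>x. G x $ k $ j) z)" for i j k
  proof -
    have "frechet_derivative (\<lambda>x. G x $ j $ k) (at z) = frechet_derivative (\<lambda>x. cnj (G x $ k $ j)) (at z)"
      by (rule frechet_derivative_transform_within_open [OF diff S z])
        (use pd in \<open>unfold hermitian_pos_def_def, blast\<close>)
    then have "d_dzbar i (\<lambda>x. G x $ j $ k) z = d_dzbar i (\<lambda>x. cnj (G x $ k $ j)) z"
      by (simp add: d_dzbar_def)
    then show ?thesis by (simp add: d_dzbar_cnj diff)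
  qed
  show "d_dzbar i (\<lambda>x. G x $ j $ k) z = d_dzbar k (\<lambda>x. G x $ j $ i) z" for i j k
    unfolding bar using dz by simp
qed

section \<open>Kaehler-like metrics of constant mixed curvature\<close>

theorem theorem1p5:
  fixes M :: "'a topology"
    and \<A> :: "('a, 'n::finite) chart set"
    and g :: "('a, 'n) chart \<Rightarrow> complex^'n \<Rightarrow> complex^'n^'n"
    and \<alpha> \<beta> c :: real
  assumes "\<beta> \<noteq> 0"
    and "hermitian_manifold M \<A> g"
    and "chern_kaehler_like \<A> g"
    and "c \<noteq> 0"
    and "constant_mixed_curvature \<A> g \<alpha> \<beta> c"
    and "(real CARD('n) + 2) * \<alpha> + 4 * \<beta> \<noteq> 0"
  shows "kaehler \<A> g"
  unfolding kaehler_def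
proof (intro ballI allI)
  fix C z u v w
  assume C: "C \<in> \<A>" and z: "z \<in> chart_image C"
  let ?G = "g C" and ?S = "chart_image C"
  let ?n = "of_nat CARD('n) :: complex"
  have S: "open ?S"
    using assms(2) C unfolding hermitian_manifold_def complex_manifold_def by blast
  have G: "smooth_on ?G ?S" and pd: "\<And>x. x \<in> ?S \<Longrightarrow> hermitian_pos_def (?G x)"
    using assms(2) C unfolding hermitian_manifold_def hermitian_metric_def by blast+
  define a where "a = ((?n + 1) * of_real \<alpha> + 2 * of_real \<beta>) / (of_real c * (?n + 1))"
  show "ext_deriv2 (fundamental_form ?G) z u v w = 0"
  proof (rule ricci_proportional_imp_closed [OF S z G pd])
    fix x i j assume x: "x \<in> ?S"
    have det: "det (?G x) \<notin> \<real>\<^sub>\<le>\<^sub>0" if "x \<in> ?S" for x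
      using hermitian_pos_def_det_pos [OF pd [OF that]] by (auto simp: complex_nonpos_Reals_iff)
    have "((?n + 1) * of_real \<alpha> + 2 * of_real \<beta>) * chern_ricci ?G x i j
      = of_real c * (?n + 1) * ?G x $ i $ j"
    proof (rule ricci_proportional_of_constant_mixed [where R = "chern_curvature ?G x"])
      show "det (?G x) \<noteq> 0" using det [OF x] by auto
      show "chern_curvature ?G x i j k l = chern_curvature ?G x k j i l" for i j k l
        using assms(3) C x unfolding chern_kaehler_like_def by blast
      show "chern_curvature ?G x i j k l = chern_curvature ?G x i l k j" for i j k l
        using assms(3) C x unfolding chern_kaehler_like_def by blast
      show "chern_ricci ?G x i j
          = (\<Sum>k\<in>UNIV. \<Sum>l\<in>UNIV. metric_inv (?G x) k l * chern_curvature ?G x i j k l)" for i j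
        by (rule chern_ricci_eq_trace [OF S x G det])
      have "of_real ((real CARD('n) + 2) * \<alpha> + 4 * \<beta>) \<noteq> (0 :: complex)"
        unfolding of_real_eq_0_iff by (rule assms(6))
      then show "(?n + 2) * of_real \<alpha> + 4 * of_real \<beta> \<noteq> 0" by simp
    next
      fix X :: "complex^'n"
      let ?h = "hermitian_form (?G x) X X" and ?r = "hermitian_form (\<chi> i j. chern_ricci ?G x i j) X X"
      let ?s = "\<Sum>i\<in>UNIV. \<Sum>j\<in>UNIV. \<Sum>k\<in>UNIV. \<Sum>l\<in>UNIV.
        chern_curvature ?G x i j k l * X $ i * cnj (X $ j) * X $ k * cnj (X $ l)"
      show "of_real \<alpha> * ?r * ?h + of_real \<beta> * ?s = of_real c * ?h\<^sup>2"
      \<comment> \<open>The curvature quotients carry information for \<open>X \<noteq> 0\<close> only; at \<open>X = 0\<close> both sides vanish.\<close>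
      proof (cases "X = 0")
        case False
        have "?h \<noteq> 0"
          using pd [OF x] False unfolding hermitian_pos_def_def by (metis less_irrefl zero_complex.sel(1))
        moreover have "of_real \<alpha> / ?h * ?r + of_real \<beta> * (?s / ?h\<^sup>2) = of_real c"
          using assms(5) C x False
          unfolding constant_mixed_curvature_def mixed_curvature_def ricci_form_value_def
            holomorphic_sectional_curvature_def
          by (simp add: hermitian_form_def)
        ultimately show ?thesis by (simp add: field_simps power2_eq_square)
      qed simp
    qed
    moreover have "of_nat (Suc CARD('n)) \<noteq> (0 :: complex)" by (rule of_nat_neq_0)
    then have "of_real c * (?n + 1) \<noteq> 0"
      using assms(4) by (simp add: add.commute)
    ultimately show "?G x $ i $ j = a * chern_ricci ?G x i j"
      by (simp add: a_def field_simps)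
  qed
qed

end
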